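(* Let $(A,\alpha,\mu)$ be a Hom-associative algebra and let $r,s$ be two $\alpha$-invariant elements of $A^{\otimes 2}$. Define $\triangle',\delta_r,\delta_s:A\to A\otimes A$ by $\triangle'(a)=ar-sa$, $\delta_r(a)=ar-ra$, $\delta_s(a)=as-sa$. Then the following are equivalent: (i) $(A,\alpha,\mu,\triangle',\delta_r,\delta_s)$ is a quasitriangular covariant Hom-bialgebra; (ii) $(\alpha\otimes\triangle')(r)=r_{13}r_{12}$ and $(\triangle'\otimes\alpha)(s)=-s_{23}s_{13}$; (iii) the following identities of maps $A^*\otimes A^*\to A$ hold: $$\mu^{\mathrm{op}}\circ(\rho_1^r\otimes\rho_1^r)=\rho_2^r\circ\triangle'^*,\qquad-\mu^{\mathrm{op}}\circ(\lambda_1^s\otimes\lambda_1^s)=\lambda_2^s\circ\triangle'^*,$$ where $\rho_1^r,\rho_2^r,\lambda_1^s,\lambda_2^s:A^*\to A$ are the maps defined by $$\rho_1^r(\phi)=r_{(1)}\langle\phi,\alpha(r_{(2)})\rangle,\qquad\rho_2^r(\phi)=\alpha(r_{(1)})\langle\phi,r_{(2)}\rangle,$$ $$\lambda_1^s(\phi)=\langle\phi,\alpha(s_{(1)})\rangle s_{(2)},\qquad\lambda_2^s(\phi)=\langle\phi,s_{(1)}\rangle\alpha(s_{(2)}).$$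
   Context: All vector spaces, linear maps and tensor products are over a field $\mathbb{K}$. A (multiplicative) Hom-associative algebra $(A,\alpha,\mu)$ is a vector space $A$ with a linear map $\alpha:A\to A$ and a bilinear map $\mu:A\otimes A\to A$, $a\otimes b\mapsto a\cdot b$, such that $(a\cdot b)\cdot\alpha(c)=\alpha(a)\cdot(b\cdot c)$ and $\alpha(a\cdot b)=\alpha(a)\cdot\alpha(b)$ for all $a,b,c\in A$ (multiplicativity is always assumed). $\mu^{\mathrm{op}}(a\otimes b)=b\cdot a$. Elements of $A^{\otimes 2}$ are written $r=r_{(1)}\otimes r_{(2)}$ with the (finite) summation sign suppressed; $r$ is $\alpha$-invariant if $(\alpha\otimes\alpha)(r)=r$. For $a\in A$ and $r\in A^{\otimes 2}$, $$ar=a\cdot r_{(1)}\otimes\alpha(r_{(2)}),\qquad ra=\alpha(r_{(1)})\otimes r_{(2)}\cdot a.$$ For $\alpha$-invariant $r,s\in A^{\otimes 2}$ define elements of $A^{\otimes 3}$ by $$r_{13}s_{12}=r_{(1)}\cdot s_{(1)}\otimes\alpha(s_{(2)})\otimes\alpha(r_{(2)}),$$ $$r_{12}s_{23}=\alpha(r_{(1)})\otimes r_{(2)}\cdot s_{(1)}\otimes\alpha(s_{(2)}),$$ $$r_{23}s_{13}=\alpha(s_{(1)})\otimes\alpha(r_{(1)})\otimes r_{(2)}\cdot s_{(2)}$$ (the same formulas are used when both elements coincide, with two independent copies). A pair $(r,s)$ of $\alpha$-invariant elements is a Hom-Yang-Baxter pair if $$r_{13}r_{12}-r_{12}r_{23}+s_{23}r_{13}=0,\qquad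 s_{13}r_{12}-s_{12}s_{23}+s_{23}s_{13}=0.$$ Quasitriangular: a covariant Hom-bialgebra $(A,\alpha,\mu,\triangle,\delta_1,\delta_2)$ consists of a Hom-associative algebra $(A,\alpha,\mu)$ and linear maps $\triangle,\delta_1,\delta_2:A\to A\otimes A$ commuting with $\alpha$ (i.e. $\alpha^{\otimes 2}\circ f=f\circ\alpha$ for each of them) such that $(\triangle\otimes\alpha)\circ\triangle=(\alpha\otimes\triangle)\circ\triangle$, $\delta_i\circ\mu=(\mu\otimes\alpha)\circ(\alpha\otimes\delta_i)+(\alpha\otimes\mu)\circ(\delta_i\otimes\alpha)$ for $i=1,2$, and $\triangle\circ\mu=(\mu\otimes\alpha)\circ(\alpha\otimes\delta_1)+(\alpha\otimes\mu)\circ(\triangle\otimes\alpha)=(\mu\otimes\alpha)\circ(\alpha\otimes\triangle)+(\alpha\otimes\mu)\circ(\delta_2\otimes\alpha)$. When $(r,s)$ is a Hom-Yang-Baxter pair, the tuple $(A,\alpha,\mu,\triangle',\delta_r,\delta_s)$ is a covariant Hom-bialgebra, and it is then called quasitriangular; thus, by definition, $(A,\alpha,\mu,\triangle',\delta_r,\delta_s)$ is a quasitriangular covariant Hom-bialgebra if and only if $(r,s)$ is a Hom-Yang-Baxter pair. $A^*$ is the linear dual of $A$, and $\triangle'^*:A^*\otimes A^*\to A^*$ is given by $\langle\triangle'^*(\phi\otimes\psi),a\rangle=\langle\phi\otimes\psi,\triangle'(a)\rangle$. *)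

theory Defs
  imports Complex_Main "HOL-Library.Function_Algebras"
begin

section \<open>Tensor powers of a vector space\<close>

text \<open>
  Vector spaces are subspaces \<open>V\<close> of a type carrying a scalar multiplication \<open>s\<close>: the underlying
  space of an algebra is the whole type, while a linear dual is a subspace of a function space.
\<close>

definition fscale :: "'k::field \<Rightarrow> ('x \<Rightarrow> 'k) \<Rightarrow> 'x \<Rightarrow> 'k"
  where "fscale c f = (\<lambda>x. c * f x)"

lemma vector_space_fscale: "vector_space fscale"
  by standard (auto simp: fscale_def fun_eq_iff algebra_simps)

lemma vector_space_mult: "vector_space ((*) :: 'k::field \<Rightarrow> 'k \<Rightarrow> 'k)"
  by standard (auto simp: algebra_simps)

definition linear_on ::
  "'v::ab_group_add set \<Rightarrow> ('k::field \<Rightarrow> 'v \<Rightarrow> 'v) \<Rightarrow> ('k \<Rightarrow> 'u \<Rightarrow> 'u) \<Rightarrow> ('v \<Rightarrow> 'u::ab_group_add) \<Rightarrow> bool"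
  where "linear_on V s s' f \<longleftrightarrow>
    (\<forall>x\<in>V. \<forall>y\<in>V. f (x + y) = f x + f y) \<and> (\<forall>c. \<forall>x\<in>V. f (s c x) = s' c (f x))"

definition bilinear_on ::
  "'v::ab_group_add set \<Rightarrow> ('k::field \<Rightarrow> 'v \<Rightarrow> 'v) \<Rightarrow> ('k \<Rightarrow> 'u \<Rightarrow> 'u) \<Rightarrow> ('v \<Rightarrow> 'v \<Rightarrow> 'u::ab_group_add) \<Rightarrow> bool"
  where "bilinear_on V s s' B \<longleftrightarrow>
    (\<forall>y\<in>V. linear_on V s s' (\<lambda>x. B x y)) \<and> (\<forall>x\<in>V. linear_on V s s' (\<lambda>y. B x y))"

definition trilinear_on ::
  "'v::ab_group_add set \<Rightarrow> ('k::field \<Rightarrow> 'v \<Rightarrow> 'v) \<Rightarrow> ('k \<Rightarrow> 'u \<Rightarrow> 'u) \<Rightarrow> ('v \<Rightarrow> 'v \<Rightarrow> 'v \<Rightarrow> 'u::ab_group_add) \<Rightarrow> bool"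
  where "trilinear_on V s s' T \<longleftrightarrow>
    (\<forall>y\<in>V. \<forall>z\<in>V. linear_on V s s' (\<lambda>x. T x y z)) \<and>
    (\<forall>x\<in>V. \<forall>z\<in>V. linear_on V s s' (\<lambda>y. T x y z)) \<and>
    (\<forall>x\<in>V. \<forall>y\<in>V. linear_on V s s' (\<lambda>z. T x y z))"

text \<open>
  The elementary tensor \<open>x \<otimes> y\<close> is realised as evaluation at \<open>(x, y)\<close> on the bilinear forms on \<open>V\<close>,
  and \<open>V \<otimes> V\<close> as the linear span of the elementary tensors; likewise for three factors.  Over a
  field this is the tensor product: the universal property is lemmas \<open>sweedler2_elementary\<close> to
  \<open>sweedler2_unique\<close> below, and their analogues for three factors.
\<close>

type_synonym ('k, 'v) tensor2 = "('v \<Rightarrow> 'v \<Rightarrow> 'k) \<Rightarrow> 'k"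
type_synonym ('k, 'v) tensor3 = "('v \<Rightarrow> 'v \<Rightarrow> 'v \<Rightarrow> 'k) \<Rightarrow> 'k"

definition elem2 :: "'v::ab_group_add set \<Rightarrow> ('k::field \<Rightarrow> 'v \<Rightarrow> 'v) \<Rightarrow> 'v \<Rightarrow> 'v \<Rightarrow> ('k, 'v) tensor2"
  where "elem2 V s x y = (\<lambda>\<beta>. if bilinear_on V s (*) \<beta> then \<beta> x y else 0)"

definition elem3 :: "'v::ab_group_add set \<Rightarrow> ('k::field \<Rightarrow> 'v \<Rightarrow> 'v) \<Rightarrow> 'v \<Rightarrow> 'v \<Rightarrow> 'v \<Rightarrow> ('k, 'v) tensor3"
  where "elem3 V s x y z = (\<lambda>\<tau>. if trilinear_on V s (*) \<tau> then \<tau> x y z else 0)"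

definition tensor2_space :: "'v::ab_group_add set \<Rightarrow> ('k::field \<Rightarrow> 'v \<Rightarrow> 'v) \<Rightarrow> ('k, 'v) tensor2 set"
  where "tensor2_space V s = module.span fscale {elem2 V s x y | x y. x \<in> V \<and> y \<in> V}"

definition tensor3_space :: "'v::ab_group_add set \<Rightarrow> ('k::field \<Rightarrow> 'v \<Rightarrow> 'v) \<Rightarrow> ('k, 'v) tensor3 set"
  where "tensor3_space V s = module.span fscale {elem3 V s x y z | x y z. x \<in> V \<and> y \<in> V \<and> z \<in> V}"

definition elem2_sum :: "'v::ab_group_add set \<Rightarrow> ('k::field \<Rightarrow> 'v \<Rightarrow> 'v) \<Rightarrow> ('v \<times> 'v) list \<Rightarrow> ('k, 'v) tensor2"
  where "elem2_sum V s xs = (\<Sum>(x, y)\<leftarrow>xs. elem2 V s x y)"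

definition elem3_sum :: "'v::ab_group_add set \<Rightarrow> ('k::field \<Rightarrow> 'v \<Rightarrow> 'v) \<Rightarrow> ('v \<times> 'v \<times> 'v) list \<Rightarrow> ('k, 'v) tensor3"
  where "elem3_sum V s xs = (\<Sum>(x, y, z)\<leftarrow>xs. elem3 V s x y z)"

text \<open>
  Sweedler-type notation: for \<open>t = t\<^sub>1 \<otimes> t\<^sub>2\<close> (summation suppressed),
  \<open>sweedler2 V s t B\<close> is the sum \<open>B t\<^sub>1 t\<^sub>2\<close>.  For bilinear \<open>B\<close> it does not depend on the chosen
  representation of \<open>t\<close>, and \<open>t \<mapsto> sweedler2 V s t B\<close> is the linear map on \<open>V \<otimes> V\<close> induced by \<open>B\<close>.
\<close>

definition sweedler2 ::
  "'v::ab_group_add set \<Rightarrow> ('k::field \<Rightarrow> 'v \<Rightarrow> 'v) \<Rightarrow> ('k, 'v) tensor2 \<Rightarrow> ('v \<Rightarrow> 'v \<Rightarrow> 'u::ab_group_add) \<Rightarrow> 'u"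
  where "sweedler2 V s t B =
    (\<Sum>(x, y)\<leftarrow>(SOME xs. set xs \<subseteq> V \<times> V \<and> t = elem2_sum V s xs). B x y)"

definition sweedler3 ::
  "'v::ab_group_add set \<Rightarrow> ('k::field \<Rightarrow> 'v \<Rightarrow> 'v) \<Rightarrow> ('k, 'v) tensor3 \<Rightarrow> ('v \<Rightarrow> 'v \<Rightarrow> 'v \<Rightarrow> 'u::ab_group_add) \<Rightarrow> 'u"
  where "sweedler3 V s t T =
    (\<Sum>(x, y, z)\<leftarrow>(SOME xs. set xs \<subseteq> V \<times> V \<times> V \<and> t = elem3_sum V s xs). T x y z)"

subsection \<open>The universal property\<close>

lemma linear_on_sum_list:
  assumes "linear_on UNIV s s' f"
  shows "f (\<Sum>x\<leftarrow>xs. g x) = (\<Sum>x\<leftarrow>xs. f (g x))"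
proof -
  have "f (0 + 0) = f 0 + f 0" using assms unfolding linear_on_def by blast
  then have "f 0 = 0" by simp
  then show ?thesis using assms by (induction xs) (auto simp: linear_on_def)
qed

lemma separating_functional:
  assumes "vector_space s" "\<And>f. linear_on UNIV s (*) f \<Longrightarrow> f u = (f v :: 'k::field)"
  shows "u = (v :: 'u::ab_group_add)"
proof (rule ccontr)
  assume "u \<noteq> v"
  interpret vector_space_pair s "(*) :: 'k \<Rightarrow> 'k \<Rightarrow> 'k"
    using assms(1) vector_space_mult by (simp add: vector_space_pair_def)
  have "vs1.independent {u - v}"
    using \<open>u \<noteq> v\<close> by (simp add: vs1.dependent_single)
  from linear_independent_extend[OF this, of "\<lambda>_. 1"]
  obtain g where g: "Vector_Spaces.linear s (*) g" "g (u - v) = (1 :: 'k)" by auto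
  then have "linear_on UNIV s (*) g"
    by (simp add: linear_on_def linear_add linear_scale)
  then have "g u = g v" by (rule assms(2))
  moreover have "g (u - v) = g u - g v" using g(1) by (rule linear_diff)
  ultimately show False using g(2) by simp
qed

lemma bilinear_on_comp:
  "bilinear_on V s s' B \<Longrightarrow> linear_on UNIV s' s'' f \<Longrightarrow> bilinear_on V s s'' (\<lambda>x y. f (B x y))"
  by (simp add: bilinear_on_def linear_on_def)

lemma trilinear_on_comp:
  "trilinear_on V s s' B \<Longrightarrow> linear_on UNIV s' s'' f \<Longrightarrow> trilinear_on V s s'' (\<lambda>x y z. f (B x y z))"
  by (simp add: trilinear_on_def linear_on_def)

lemma elem2_sum_simps:
  "elem2_sum V s [] = 0" "elem2_sum V s ((x, y) # xs) = elem2 V s x y + elem2_sum V s xs"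
  "elem2_sum V s (xs @ ys) = elem2_sum V s xs + elem2_sum V s ys"
  unfolding elem2_sum_def by (simp_all only: list.map map_append sum_list.Nil sum_list.Cons
      sum_list.append case_prod_conv)

lemma elem3_sum_simps:
  "elem3_sum V s [] = 0" "elem3_sum V s ((x, y, z) # xs) = elem3 V s x y z + elem3_sum V s xs"
  "elem3_sum V s (xs @ ys) = elem3_sum V s xs + elem3_sum V s ys"
  unfolding elem3_sum_def by (simp_all only: list.map map_append sum_list.Nil sum_list.Cons
      sum_list.append case_prod_conv)

lemma elem2_sum_apply:
  "bilinear_on V s (*) \<beta> \<Longrightarrow> elem2_sum V s xs \<beta> = (\<Sum>(x, y)\<leftarrow>xs. \<beta> x y)"
  proof (induction xs)
  case (Cons p xs)
  then show ?case by (cases p) (simp only: elem2_sum_simps plus_fun_apply elem2_def if_True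
      list.map case_prod_conv sum_list.Cons)
qed (simp add: elem2_sum_simps)

lemma elem3_sum_apply:
  "trilinear_on V s (*) \<beta> \<Longrightarrow> elem3_sum V s xs \<beta> = (\<Sum>(x, y, z)\<leftarrow>xs. \<beta> x y z)"
  proof (induction xs)
  case (Cons p xs)
  then show ?case by (cases p) (simp only: elem3_sum_simps plus_fun_apply elem3_def if_True
      list.map case_prod_conv sum_list.Cons)
qed (simp add: elem3_sum_simps)

lemma bilinear_on_elem2: "bilinear_on V s fscale (elem2 V s)"
proof -
  have "linear_on V s fscale (\<lambda>x. elem2 V s x y)" "linear_on V s fscale (\<lambda>x. elem2 V s y x)"
    if y: "y \<in> V" for y
  proof -
    have "linear_on V s (*) (\<lambda>x. \<beta> x y)" "linear_on V s (*) (\<lambda>x. \<beta> y x)"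
      if "bilinear_on V s (*) \<beta>" for \<beta>
      using that y by (simp_all add: bilinear_on_def)
    then show "linear_on V s fscale (\<lambda>x. elem2 V s x y)" "linear_on V s fscale (\<lambda>x. elem2 V s y x)"
      by (simp_all add: linear_on_def[of V s] elem2_def fscale_def fun_eq_iff)
  qed
  then show ?thesis by (simp add: bilinear_on_def[of V s fscale])
qed

lemma trilinear_on_elem3: "trilinear_on V s fscale (elem3 V s)"
proof -
  have "linear_on V s fscale (\<lambda>x. elem3 V s x y z)" "linear_on V s fscale (\<lambda>x. elem3 V s y x z)"
    "linear_on V s fscale (\<lambda>x. elem3 V s y z x)"
    if yz: "y \<in> V" "z \<in> V" for y z
  proof -
    have "linear_on V s (*) (\<lambda>x. \<tau> x y z)" "linear_on V s (*) (\<lambda>x. \<tau> y x z)"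
      "linear_on V s (*) (\<lambda>x. \<tau> y z x)" if "trilinear_on V s (*) \<tau>" for \<tau>
      using that yz by (simp_all add: trilinear_on_def)
    then show "linear_on V s fscale (\<lambda>x. elem3 V s x y z)" "linear_on V s fscale (\<lambda>x. elem3 V s y x z)"
      "linear_on V s fscale (\<lambda>x. elem3 V s y z x)"
      by (simp_all add: linear_on_def[of V s] elem3_def fscale_def fun_eq_iff)
  qed
  then show ?thesis by (simp add: trilinear_on_def[of V s fscale])
qed

lemma elem2_sum_welldef:
  assumes "vector_space s'" "bilinear_on V s s' B"
    "elem2_sum V s xs = elem2_sum V s ys"
  shows "(\<Sum>(x, y)\<leftarrow>xs. B x y) = (\<Sum>(x, y)\<leftarrow>ys. B x y)"
proof (rule separating_functional[OF assms(1)])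
  fix f assume f: "linear_on UNIV s' (*) f"
  have "f (\<Sum>(x, y)\<leftarrow>zs. B x y) = elem2_sum V s zs (\<lambda>x y. f (B x y))" for zs
    using elem2_sum_apply[OF bilinear_on_comp[OF assms(2) f]] linear_on_sum_list[OF f]
    by (simp add: case_prod_unfold)
  then show "f (\<Sum>(x, y)\<leftarrow>xs. B x y) = f (\<Sum>(x, y)\<leftarrow>ys. B x y)"
    by (simp add: assms(3))
qed

lemma elem3_sum_welldef:
  assumes "vector_space s'" "trilinear_on V s s' B"
    "elem3_sum V s xs = elem3_sum V s ys"
  shows "(\<Sum>(x, y, z)\<leftarrow>xs. B x y z) = (\<Sum>(x, y, z)\<leftarrow>ys. B x y z)"
proof (rule separating_functional[OF assms(1)])
  fix f assume f: "linear_on UNIV s' (*) f"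
  have "f (\<Sum>(x, y, z)\<leftarrow>zs. B x y z) = elem3_sum V s zs (\<lambda>x y z. f (B x y z))" for zs
    using elem3_sum_apply[OF trilinear_on_comp[OF assms(2) f]] linear_on_sum_list[OF f]
    by (simp add: case_prod_unfold)
  then show "f (\<Sum>(x, y, z)\<leftarrow>xs. B x y z) = f (\<Sum>(x, y, z)\<leftarrow>ys. B x y z)"
    by (simp add: assms(3))
qed

lemma sweedler2_elem2_sum:
  assumes "vector_space s'" "bilinear_on V s s' B" "set xs \<subseteq> V \<times> V"
  shows "sweedler2 V s (elem2_sum V s xs) B = (\<Sum>(x, y)\<leftarrow>xs. B x y)"
proof -
  let ?P = "\<lambda>ys. set ys \<subseteq> V \<times> V \<and> elem2_sum V s xs = elem2_sum V s ys"
  have "?P (SOME ys. ?P ys)" using assms(3) by (intro someI[of ?P xs]) simp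
  then have "elem2_sum V s xs = elem2_sum V s (SOME ys. ?P ys)" by (rule conjunct2)
  from elem2_sum_welldef[OF assms(1,2) this] show ?thesis unfolding sweedler2_def by (rule sym)
qed

lemma sweedler3_elem3_sum:
  assumes "vector_space s'" "trilinear_on V s s' B" "set xs \<subseteq> V \<times> V \<times> V"
  shows "sweedler3 V s (elem3_sum V s xs) B = (\<Sum>(x, y, z)\<leftarrow>xs. B x y z)"
proof -
  let ?P = "\<lambda>ys. set ys \<subseteq> V \<times> V \<times> V \<and> elem3_sum V s xs = elem3_sum V s ys"
  have "?P (SOME ys. ?P ys)" using assms(3) by (intro someI[of ?P xs]) simp
  then have "elem3_sum V s xs = elem3_sum V s (SOME ys. ?P ys)" by (rule conjunct2)
  from elem3_sum_welldef[OF assms(1,2) this] show ?thesis unfolding sweedler3_def by (rule sym)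
qed

lemma elem2_sum_scale:
  assumes "vector_space s" "module.subspace s V" "set xs \<subseteq> V \<times> V"
  shows "fscale c (elem2_sum V s xs) = elem2_sum V s (map (\<lambda>(x, y). (s c x, y)) xs)"
  using assms(3)
proof (induction xs)
  case Nil show ?case by (simp add: elem2_sum_def fscale_def fun_eq_iff)
next
  case (Cons p xs)
  obtain x y where p: "p = (x, y)" by fastforce
  interpret F: vector_space fscale by (rule vector_space_fscale)
  have "fscale c (elem2 V s x y) = elem2 V s (s c x) y"
    using bilinear_on_elem2[of V s] Cons(2) by (simp add: p bilinear_on_def linear_on_def)
  moreover have "fscale c (elem2_sum V s xs) = elem2_sum V s (map (\<lambda>(x, y). (s c x, y)) xs)"
    using Cons by simp
  ultimately show ?case
    by (simp only: p list.map case_prod_conv elem2_sum_simps F.scale_right_distrib)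
qed

lemma elem3_sum_scale:
  assumes "vector_space s" "module.subspace s V" "set xs \<subseteq> V \<times> V \<times> V"
  shows "fscale c (elem3_sum V s xs) = elem3_sum V s (map (\<lambda>(x, y, z). (s c x, y, z)) xs)"
  using assms(3)
proof (induction xs)
  case Nil show ?case by (simp add: elem3_sum_def fscale_def fun_eq_iff)
next
  case (Cons p xs)
  obtain x y z where p: "p = (x, y, z)" by (cases p) auto
  interpret F: vector_space fscale by (rule vector_space_fscale)
  have "fscale c (elem3 V s x y z) = elem3 V s (s c x) y z"
    using trilinear_on_elem3[of V s] Cons(2) by (simp add: p trilinear_on_def linear_on_def)
  moreover have "fscale c (elem3_sum V s xs) = elem3_sum V s (map (\<lambda>(x, y, z). (s c x, y, z)) xs)"
    using Cons by simp
  ultimately show ?case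
    by (simp only: p list.map case_prod_conv elem3_sum_simps F.scale_right_distrib)
qed

lemma tensor2_space_eq:
  assumes "vector_space s" "module.subspace s V"
  shows "tensor2_space V s = {elem2_sum V s xs | xs. set xs \<subseteq> V \<times> V}" (is "_ = ?R")
proof
  interpret S: vector_space s by fact
  interpret F: vector_space fscale by (rule vector_space_fscale)
  let ?G = "{elem2 V s x y | x y. x \<in> V \<and> y \<in> V}"
  have "F.subspace ?R"
    unfolding F.subspace_def
  proof (intro conjI allI ballI)
    show "0 \<in> ?R" by (auto simp: elem2_sum_def intro!: exI[of _ "[]"])
  next
    fix t u assume "t \<in> ?R" "u \<in> ?R"
    then obtain xs ys where "set xs \<subseteq> V \<times> V" "set ys \<subseteq> V \<times> V"
      "t = elem2_sum V s xs" "u = elem2_sum V s ys" by blast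
    then show "t + u \<in> ?R" by (auto simp: elem2_sum_def intro!: exI[of _ "xs @ ys"])
  next
    fix c t assume "t \<in> ?R"
    then obtain xs where xs: "set xs \<subseteq> V \<times> V" "t = elem2_sum V s xs" by blast
    then have "set (map (\<lambda>(x, y). (s c x, y)) xs) \<subseteq> V \<times> V"
      using assms(2) by (auto dest: S.subspace_scale)
    then show "fscale c t \<in> ?R" using elem2_sum_scale[OF assms xs(1)] xs(2) by blast
  qed
  moreover have "?G \<subseteq> ?R"
  proof
    fix t assume "t \<in> ?G"
    then obtain x y where "x \<in> V" "y \<in> V" "t = elem2 V s x y" by blast
    then show "t \<in> ?R" by (auto simp: elem2_sum_def intro!: exI[of _ "[(x, y)]"])
  qed
  ultimately show "tensor2_space V s \<subseteq> ?R"
    unfolding tensor2_space_def by (intro F.span_minimal)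
  have "elem2_sum V s xs \<in> F.span ?G" if "set xs \<subseteq> V \<times> V" for xs
    using that
  proof (induction xs)
    case Nil show ?case unfolding elem2_sum_simps by (rule F.span_zero)
  next
    case (Cons p xs)
    obtain x y where p: "p = (x, y)" by fastforce
    have "elem2 V s x y \<in> F.span ?G" using Cons(2) by (intro F.span_base) (auto simp: p)
    moreover have "elem2_sum V s xs \<in> F.span ?G" using Cons by simp
    ultimately show ?case unfolding p elem2_sum_simps by (rule F.span_add)
  qed
  then show "?R \<subseteq> tensor2_space V s" unfolding tensor2_space_def by blast
qed

lemma tensor3_space_eq:
  assumes "vector_space s" "module.subspace s V"
  shows "tensor3_space V s = {elem3_sum V s xs | xs. set xs \<subseteq> V \<times> V \<times> V}" (is "_ = ?R")
proof
  interpret S: vector_space s by fact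
  interpret F: vector_space fscale by (rule vector_space_fscale)
  let ?G = "{elem3 V s x y z | x y z. x \<in> V \<and> y \<in> V \<and> z \<in> V}"
  have "F.subspace ?R"
    unfolding F.subspace_def
  proof (intro conjI allI ballI)
    show "0 \<in> ?R" by (auto simp: elem3_sum_def intro!: exI[of _ "[]"])
  next
    fix t u assume "t \<in> ?R" "u \<in> ?R"
    then obtain xs ys where "set xs \<subseteq> V \<times> V \<times> V" "set ys \<subseteq> V \<times> V \<times> V"
      "t = elem3_sum V s xs" "u = elem3_sum V s ys" by blast
    then show "t + u \<in> ?R" by (auto simp: elem3_sum_def intro!: exI[of _ "xs @ ys"])
  next
    fix c t assume "t \<in> ?R"
    then obtain xs where xs: "set xs \<subseteq> V \<times> V \<times> V" "t = elem3_sum V s xs" by blast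
    then have "set (map (\<lambda>(x, y, z). (s c x, y, z)) xs) \<subseteq> V \<times> V \<times> V"
      using assms(2) by (auto dest: S.subspace_scale)
    then show "fscale c t \<in> ?R" using elem3_sum_scale[OF assms xs(1)] xs(2) by blast
  qed
  moreover have "?G \<subseteq> ?R"
  proof
    fix t assume "t \<in> ?G"
    then obtain x y z where "x \<in> V" "y \<in> V" "z \<in> V" "t = elem3 V s x y z" by blast
    then show "t \<in> ?R" by (auto simp: elem3_sum_def intro!: exI[of _ "[(x, y, z)]"])
  qed
  ultimately show "tensor3_space V s \<subseteq> ?R"
    unfolding tensor3_space_def by (intro F.span_minimal)
  have "elem3_sum V s xs \<in> F.span ?G" if "set xs \<subseteq> V \<times> V \<times> V" for xs
    using that
  proof (induction xs)
    case Nil show ?case unfolding elem3_sum_simps by (rule F.span_zero)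
  next
    case (Cons p xs)
    obtain x y z where p: "p = (x, y, z)" by (cases p) auto
    have "elem3 V s x y z \<in> F.span ?G" using Cons(2) by (intro F.span_base) (auto simp: p)
    moreover have "elem3_sum V s xs \<in> F.span ?G" using Cons by simp
    ultimately show ?case unfolding p elem3_sum_simps by (rule F.span_add)
  qed
  then show "?R \<subseteq> tensor3_space V s" unfolding tensor3_space_def by blast
qed

lemma sweedler2_elementary:
  assumes "vector_space s'" "bilinear_on V s s' B" "x \<in> V" "y \<in> V"
  shows "sweedler2 V s (elem2 V s x y) B = B x y"
  using sweedler2_elem2_sum[OF assms(1,2), of "[(x, y)]"] assms(3,4) by (simp add: elem2_sum_def)

lemma sweedler3_elementary:
  assumes "vector_space s'" "trilinear_on V s s' B" "x \<in> V" "y \<in> V" "z \<in> V"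
  shows "sweedler3 V s (elem3 V s x y z) B = B x y z"
  using sweedler3_elem3_sum[OF assms(1,2), of "[(x, y, z)]"] assms(3-5) by (simp add: elem3_sum_def)

lemma sweedler2_linear:
  assumes "vector_space s" "module.subspace s V" "vector_space s'" "bilinear_on V s s' B"
  shows "linear_on (tensor2_space V s) fscale s' (\<lambda>t. sweedler2 V s t B)"
  unfolding linear_on_def tensor2_space_eq[OF assms(1,2)]
proof (intro conjI allI ballI)
  fix t u assume "t \<in> {elem2_sum V s xs | xs. set xs \<subseteq> V \<times> V}"
    "u \<in> {elem2_sum V s xs | xs. set xs \<subseteq> V \<times> V}"
  then obtain xs ys where *: "set xs \<subseteq> V \<times> V" "set ys \<subseteq> V \<times> V"
    "t = elem2_sum V s xs" "u = elem2_sum V s ys" by blast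
  then have "t + u = elem2_sum V s (xs @ ys)" by (simp add: elem2_sum_def)
  with * show "sweedler2 V s (t + u) B = sweedler2 V s t B + sweedler2 V s u B"
    by (simp add: sweedler2_elem2_sum[OF assms(3,4)])
next
  interpret S: vector_space s by fact
  interpret S': vector_space s' by fact
  fix c t assume "t \<in> {elem2_sum V s xs | xs. set xs \<subseteq> V \<times> V}"
  then obtain xs where xs: "set xs \<subseteq> V \<times> V" "t = elem2_sum V s xs" by blast
  then have "set (map (\<lambda>(x, y). (s c x, y)) xs) \<subseteq> V \<times> V"
    using assms(2) by (auto dest: S.subspace_scale)
  then have "sweedler2 V s (fscale c t) B = (\<Sum>(x, y)\<leftarrow>map (\<lambda>(x, y). (s c x, y)) xs. B x y)"
    using elem2_sum_scale[OF assms(1,2) xs(1)] xs(2) sweedler2_elem2_sum[OF assms(3,4)] by simp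
  also have "\<dots> = s' c (\<Sum>(x, y)\<leftarrow>xs. B x y)"
    using xs(1) assms(4)
    by (induction xs) (auto simp: S'.scale_right_distrib bilinear_on_def linear_on_def)
  finally show "sweedler2 V s (fscale c t) B = s' c (sweedler2 V s t B)"
    using xs sweedler2_elem2_sum[OF assms(3,4)] by simp
qed

lemma sweedler3_linear:
  assumes "vector_space s" "module.subspace s V" "vector_space s'" "trilinear_on V s s' B"
  shows "linear_on (tensor3_space V s) fscale s' (\<lambda>t. sweedler3 V s t B)"
  unfolding linear_on_def tensor3_space_eq[OF assms(1,2)]
proof (intro conjI allI ballI)
  fix t u assume "t \<in> {elem3_sum V s xs | xs. set xs \<subseteq> V \<times> V \<times> V}"
    "u \<in> {elem3_sum V s xs | xs. set xs \<subseteq> V \<times> V \<times> V}"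
  then obtain xs ys where *: "set xs \<subseteq> V \<times> V \<times> V" "set ys \<subseteq> V \<times> V \<times> V"
    "t = elem3_sum V s xs" "u = elem3_sum V s ys" by blast
  then have "t + u = elem3_sum V s (xs @ ys)" by (simp add: elem3_sum_def)
  with * show "sweedler3 V s (t + u) B = sweedler3 V s t B + sweedler3 V s u B"
    by (simp add: sweedler3_elem3_sum[OF assms(3,4)])
next
  interpret S: vector_space s by fact
  interpret S': vector_space s' by fact
  fix c t assume "t \<in> {elem3_sum V s xs | xs. set xs \<subseteq> V \<times> V \<times> V}"
  then obtain xs where xs: "set xs \<subseteq> V \<times> V \<times> V" "t = elem3_sum V s xs" by blast
  then have "set (map (\<lambda>(x, y, z). (s c x, y, z)) xs) \<subseteq> V \<times> V \<times> V"
    using assms(2) by (auto dest: S.subspace_scale)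
  then have "sweedler3 V s (fscale c t) B
      = (\<Sum>(x, y, z)\<leftarrow>map (\<lambda>(x, y, z). (s c x, y, z)) xs. B x y z)"
    using elem3_sum_scale[OF assms(1,2) xs(1)] xs(2) sweedler3_elem3_sum[OF assms(3,4)] by simp
  also have "\<dots> = s' c (\<Sum>(x, y, z)\<leftarrow>xs. B x y z)"
    using xs(1) assms(4)
    by (induction xs) (auto simp: S'.scale_right_distrib trilinear_on_def linear_on_def)
  finally show "sweedler3 V s (fscale c t) B = s' c (sweedler3 V s t B)"
    using xs sweedler3_elem3_sum[OF assms(3,4)] by simp
qed

lemma linear_on_tensor2_eqI:
  assumes "linear_on (tensor2_space V s) fscale s' f" "linear_on (tensor2_space V s) fscale s' g"
    "vector_space s" "module.subspace s V"
    "\<And>x y. x \<in> V \<Longrightarrow> y \<in> V \<Longrightarrow> f (elem2 V s x y) = g (elem2 V s x y)" "t \<in> tensor2_space V s"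
  shows "f t = g t"
proof -
  have *: "h 0 = 0" if "linear_on (tensor2_space V s) fscale s' h" for h
  proof -
    have "(0 :: ('b, 'a) tensor2) \<in> tensor2_space V s"
      unfolding tensor2_space_eq[OF assms(3,4)] by (auto simp: elem2_sum_def intro!: exI[of _ "[]"])
    then have "h (0 + 0) = h 0 + h 0" using that unfolding linear_on_def by blast
    then show ?thesis by simp
  qed
  obtain xs where "set xs \<subseteq> V \<times> V" "t = elem2_sum V s xs"
    using assms(6) tensor2_space_eq[OF assms(3,4)] by blast
  moreover have "f (elem2_sum V s xs) = g (elem2_sum V s xs)" if "set xs \<subseteq> V \<times> V" for xs
    using that
  proof (induction xs)
    case Nil show ?case
      by (simp only: elem2_sum_def list.map sum_list.Nil *[OF assms(1)] *[OF assms(2)])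
  next
    case (Cons p xs)
    obtain x y where p: "p = (x, y)" by fastforce
    have "elem2 V s x y = elem2_sum V s [(x, y)]" by (simp add: elem2_sum_def)
    then have "elem2 V s x y \<in> tensor2_space V s" "elem2_sum V s xs \<in> tensor2_space V s"
      unfolding tensor2_space_eq[OF assms(3,4)] mem_Collect_eq
      using Cons(2) p by (intro exI[of _ "[(x, y)]"] exI[of _ xs]; simp)+
    moreover have "elem2_sum V s (p # xs) = elem2 V s x y + elem2_sum V s xs"
      by (simp add: p elem2_sum_def)
    moreover have "f (elem2_sum V s xs) = g (elem2_sum V s xs)" "x \<in> V" "y \<in> V"
      using Cons by (auto simp: p)
    moreover have add: "h (elem2 V s x y + elem2_sum V s xs) = h (elem2 V s x y) + h (elem2_sum V s xs)"
      if "linear_on (tensor2_space V s) fscale s' h" for h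
      using that calculation(1,2) by (simp only: linear_on_def)
    ultimately show ?case
      using assms(5) by (simp only: add[OF assms(1)] add[OF assms(2)])
  qed
  ultimately show ?thesis by blast
qed

lemma sweedler2_unique:
  assumes "vector_space s" "module.subspace s V" "vector_space s'" "bilinear_on V s s' B"
    "linear_on (tensor2_space V s) fscale s' f"
    "\<And>x y. x \<in> V \<Longrightarrow> y \<in> V \<Longrightarrow> f (elem2 V s x y) = B x y" "t \<in> tensor2_space V s"
  shows "f t = sweedler2 V s t B"
  using linear_on_tensor2_eqI[OF assms(5) sweedler2_linear[OF assms(1-4)] assms(1,2) _ assms(7)]
    assms(6) sweedler2_elementary[OF assms(3,4)] by simp

lemma linear_on_tensor3_eqI:
  assumes "linear_on (tensor3_space V s) fscale s' f" "linear_on (tensor3_space V s) fscale s' g"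
    "vector_space s" "module.subspace s V"
    "\<And>x y z. x \<in> V \<Longrightarrow> y \<in> V \<Longrightarrow> z \<in> V \<Longrightarrow> f (elem3 V s x y z) = g (elem3 V s x y z)" "t \<in> tensor3_space V s"
  shows "f t = g t"
proof -
  have *: "h 0 = 0" if "linear_on (tensor3_space V s) fscale s' h" for h
  proof -
    have "(0 :: ('b, 'a) tensor3) \<in> tensor3_space V s"
      unfolding tensor3_space_eq[OF assms(3,4)] by (auto simp: elem3_sum_def intro!: exI[of _ "[]"])
    then have "h (0 + 0) = h 0 + h 0" using that unfolding linear_on_def by blast
    then show ?thesis by simp
  qed
  obtain xs where "set xs \<subseteq> V \<times> V \<times> V" "t = elem3_sum V s xs"
    using assms(6) tensor3_space_eq[OF assms(3,4)] by blast
  moreover have "f (elem3_sum V s xs) = g (elem3_sum V s xs)" if "set xs \<subseteq> V \<times> V \<times> V" for xs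
    using that
  proof (induction xs)
    case Nil show ?case
      by (simp only: elem3_sum_def list.map sum_list.Nil *[OF assms(1)] *[OF assms(2)])
  next
    case (Cons p xs)
    obtain x y z where p: "p = (x, y, z)" by (cases p) auto
    have "elem3 V s x y z = elem3_sum V s [(x, y, z)]" by (simp add: elem3_sum_def)
    then have "elem3 V s x y z \<in> tensor3_space V s" "elem3_sum V s xs \<in> tensor3_space V s"
      unfolding tensor3_space_eq[OF assms(3,4)] mem_Collect_eq
      using Cons(2) p by (intro exI[of _ "[(x, y, z)]"] exI[of _ xs]; simp)+
    moreover have "elem3_sum V s (p # xs) = elem3 V s x y z + elem3_sum V s xs"
      by (simp add: p elem3_sum_def)
    moreover have "f (elem3_sum V s xs) = g (elem3_sum V s xs)" "x \<in> V" "y \<in> V" "z \<in> V"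
      using Cons by (auto simp: p)
    moreover have add: "h (elem3 V s x y z + elem3_sum V s xs) = h (elem3 V s x y z) + h (elem3_sum V s xs)"
      if "linear_on (tensor3_space V s) fscale s' h" for h
      using that calculation(1,2) by (simp only: linear_on_def)
    ultimately show ?case
      using assms(5) by (simp only: add[OF assms(1)] add[OF assms(2)])
  qed
  ultimately show ?thesis by blast
qed

lemma sweedler3_unique:
  assumes "vector_space s" "module.subspace s V" "vector_space s'" "trilinear_on V s s' B"
    "linear_on (tensor3_space V s) fscale s' f"
    "\<And>x y z. x \<in> V \<Longrightarrow> y \<in> V \<Longrightarrow> z \<in> V \<Longrightarrow> f (elem3 V s x y z) = B x y z" "t \<in> tensor3_space V s"
  shows "f t = sweedler3 V s t B"
  using linear_on_tensor3_eqI[OF assms(5) sweedler3_linear[OF assms(1-4)] assms(1,2) _ assms(7)]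
    assms(6) sweedler3_elementary[OF assms(3,4)] by simp

section \<open>Hom-associative algebras\<close>

definition dual :: "('k::field \<Rightarrow> 'a::ab_group_add \<Rightarrow> 'a) \<Rightarrow> ('a \<Rightarrow> 'k) set"
  where "dual scale = {\<phi>. Vector_Spaces.linear scale (*) \<phi>}"

lemma subspace_dual:
  assumes "vector_space scale"
  shows "module.subspace fscale (dual scale)"
proof -
  interpret F: vector_space fscale by (rule vector_space_fscale)
  show ?thesis
    unfolding F.subspace_def dual_def
    by (auto simp: Vector_Spaces.linear_iff fscale_def algebra_simps assms vector_space_mult)
qed

locale hom_assoc_algebra = vector_space scale
  for scale :: "'k::field \<Rightarrow> 'a::ab_group_add \<Rightarrow> 'a" (infixr "*s" 75) +
  fixes \<alpha> :: "'a \<Rightarrow> 'a" and \<mu> :: "'a \<Rightarrow> 'a \<Rightarrow> 'a" (infixl "\<cdot>" 75)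
  assumes linear_\<alpha>: "Vector_Spaces.linear scale scale \<alpha>"
    and bilinear_\<mu>: "bilinear_on UNIV scale scale (\<cdot>)"
    and hom_assoc: "(a \<cdot> b) \<cdot> \<alpha> c = \<alpha> a \<cdot> (b \<cdot> c)"
    and multiplicative: "\<alpha> (a \<cdot> b) = \<alpha> a \<cdot> \<alpha> b"
begin

abbreviation tensor (\<open>(_ \<otimes> _)\<close> [71, 71] 70)
  where "x \<otimes> y \<equiv> elem2 UNIV scale x y"
abbreviation tensor' (\<open>(_ \<otimes> _ \<otimes> _)\<close> [71, 71, 71] 70)
  where "x \<otimes> y \<otimes> z \<equiv> elem3 UNIV scale x y z"
abbreviation sw2 :: "('k, 'a) tensor2 \<Rightarrow> ('a \<Rightarrow> 'a \<Rightarrow> 'u::ab_group_add) \<Rightarrow> 'u"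
  where "sw2 \<equiv> sweedler2 UNIV scale"
abbreviation sw3 :: "('k, 'a) tensor3 \<Rightarrow> ('a \<Rightarrow> 'a \<Rightarrow> 'a \<Rightarrow> 'u::ab_group_add) \<Rightarrow> 'u"
  where "sw3 \<equiv> sweedler3 UNIV scale"

text \<open>The linear maps on \<open>A \<otimes> A\<close> given by \<open>\<mu>\<close> and by \<open>\<mu>\<^sup>o\<^sup>p\<close>.\<close>

definition mult_map :: "('k, 'a) tensor2 \<Rightarrow> 'a"
  where "mult_map t = sw2 t (\<lambda>a b. a \<cdot> b)"

definition opp_mult_map :: "('k, 'a) tensor2 \<Rightarrow> 'a"
  where "opp_mult_map t = sw2 t (\<lambda>a b. b \<cdot> a)"

text \<open>
  The maps \<open>\<alpha> \<otimes> \<alpha>\<close> on \<open>A \<otimes> A\<close>; \<open>D \<otimes> \<alpha>\<close> and \<open>\<alpha> \<otimes> D\<close> from \<open>A \<otimes> A\<close> to \<open>A \<otimes> A \<otimes> A\<close> for a linear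
  map \<open>D : A \<rightarrow> A \<otimes> A\<close>; and \<open>\<mu> \<otimes> \<alpha>\<close> and \<open>\<alpha> \<otimes> \<mu>\<close> from \<open>A \<otimes> A \<otimes> A\<close> to \<open>A \<otimes> A\<close>.
\<close>

definition \<alpha>_\<alpha> :: "('k, 'a) tensor2 \<Rightarrow> ('k, 'a) tensor2"
  where "\<alpha>_\<alpha> t = sw2 t (\<lambda>a b. \<alpha> a \<otimes> \<alpha> b)"

definition map_\<alpha> :: "('a \<Rightarrow> ('k, 'a) tensor2) \<Rightarrow> ('k, 'a) tensor2 \<Rightarrow> ('k, 'a) tensor3"
  where "map_\<alpha> D t = sw2 t (\<lambda>a b. sw2 (D a) (\<lambda>x y. x \<otimes> y \<otimes> \<alpha> b))"

definition \<alpha>_map :: "('a \<Rightarrow> ('k, 'a) tensor2) \<Rightarrow> ('k, 'a) tensor2 \<Rightarrow> ('k, 'a) tensor3"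
  where "\<alpha>_map D t = sw2 t (\<lambda>a b. sw2 (D b) (\<lambda>x y. \<alpha> a \<otimes> x \<otimes> y))"

definition \<mu>_\<alpha> :: "('k, 'a) tensor3 \<Rightarrow> ('k, 'a) tensor2"
  where "\<mu>_\<alpha> t = sw3 t (\<lambda>a b c. (a \<cdot> b) \<otimes> \<alpha> c)"

definition \<alpha>_\<mu> :: "('k, 'a) tensor3 \<Rightarrow> ('k, 'a) tensor2"
  where "\<alpha>_\<mu> t = sw3 t (\<lambda>a b c. \<alpha> a \<otimes> (b \<cdot> c))"

definition invariant :: "('k, 'a) tensor2 \<Rightarrow> bool"
  where "invariant r \<longleftrightarrow> \<alpha>_\<alpha> r = r"

definition left_act :: "'a \<Rightarrow> ('k, 'a) tensor2 \<Rightarrow> ('k, 'a) tensor2"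
  where "left_act a r = sw2 r (\<lambda>r1 r2. (a \<cdot> r1) \<otimes> \<alpha> r2)"

definition right_act :: "('k, 'a) tensor2 \<Rightarrow> 'a \<Rightarrow> ('k, 'a) tensor2"
  where "right_act r a = sw2 r (\<lambda>r1 r2. \<alpha> r1 \<otimes> (r2 \<cdot> a))"

subsection \<open>Hom-Yang-Baxter pairs\<close>

text \<open>\<open>prod_ij_kl r s\<close> is the element written \<open>r\<^sub>i\<^sub>j s\<^sub>k\<^sub>l\<close>.\<close>

definition prod_13_12 :: "('k, 'a) tensor2 \<Rightarrow> ('k, 'a) tensor2 \<Rightarrow> ('k, 'a) tensor3"
  where "prod_13_12 r s = sw2 r (\<lambda>r1 r2. sw2 s (\<lambda>s1 s2. (r1 \<cdot> s1) \<otimes> \<alpha> s2 \<otimes> \<alpha> r2))"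

definition prod_12_23 :: "('k, 'a) tensor2 \<Rightarrow> ('k, 'a) tensor2 \<Rightarrow> ('k, 'a) tensor3"
  where "prod_12_23 r s = sw2 r (\<lambda>r1 r2. sw2 s (\<lambda>s1 s2. \<alpha> r1 \<otimes> (r2 \<cdot> s1) \<otimes> \<alpha> s2))"

definition prod_23_13 :: "('k, 'a) tensor2 \<Rightarrow> ('k, 'a) tensor2 \<Rightarrow> ('k, 'a) tensor3"
  where "prod_23_13 r s = sw2 r (\<lambda>r1 r2. sw2 s (\<lambda>s1 s2. \<alpha> s1 \<otimes> \<alpha> r1 \<otimes> (r2 \<cdot> s2)))"

definition hom_Yang_Baxter_pair :: "('k, 'a) tensor2 \<Rightarrow> ('k, 'a) tensor2 \<Rightarrow> bool"
  where "hom_Yang_Baxter_pair r s \<longleftrightarrow>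
    r \<in> tensor2_space UNIV scale \<and> s \<in> tensor2_space UNIV scale \<and> invariant r \<and> invariant s \<and>
    prod_13_12 r r - prod_12_23 r r + prod_23_13 s r = 0 \<and>
    prod_13_12 s r - prod_12_23 s s + prod_23_13 s s = 0"

subsection \<open>Covariant Hom-bialgebras\<close>

definition comm_map :: "('a \<Rightarrow> ('k, 'a) tensor2) \<Rightarrow> bool"
  where "comm_map D \<longleftrightarrow>
    Vector_Spaces.linear scale fscale D \<and> range D \<subseteq> tensor2_space UNIV scale \<and>
    (\<forall>a. \<alpha>_\<alpha> (D a) = D (\<alpha> a))"

definition covariant_hom_bialgebra ::
  "('a \<Rightarrow> ('k, 'a) tensor2) \<Rightarrow> ('a \<Rightarrow> ('k, 'a) tensor2) \<Rightarrow> ('a \<Rightarrow> ('k, 'a) tensor2) \<Rightarrow> bool"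
  where "covariant_hom_bialgebra \<Delta> \<delta>\<^sub>1 \<delta>\<^sub>2 \<longleftrightarrow>
    hom_assoc_algebra scale \<alpha> \<mu> \<and>
    comm_map \<Delta> \<and> comm_map \<delta>\<^sub>1 \<and> comm_map \<delta>\<^sub>2 \<and>
    (\<forall>a. map_\<alpha> \<Delta> (\<Delta> a) = \<alpha>_map \<Delta> (\<Delta> a)) \<and>
    (\<forall>\<delta>\<in>{\<delta>\<^sub>1, \<delta>\<^sub>2}. \<forall>t\<in>tensor2_space UNIV scale.
       \<delta> (mult_map t) = \<mu>_\<alpha> (\<alpha>_map \<delta> t) + \<alpha>_\<mu> (map_\<alpha> \<delta> t)) \<and>
    (\<forall>t\<in>tensor2_space UNIV scale.
       \<Delta> (mult_map t) = \<mu>_\<alpha> (\<alpha>_map \<delta>\<^sub>1 t) + \<alpha>_\<mu> (map_\<alpha> \<Delta> t)) \<and>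
    (\<forall>t\<in>tensor2_space UNIV scale.
       \<Delta> (mult_map t) = \<mu>_\<alpha> (\<alpha>_map \<Delta> t) + \<alpha>_\<mu> (map_\<alpha> \<delta>\<^sub>2 t))"

definition coprod :: "('k, 'a) tensor2 \<Rightarrow> ('k, 'a) tensor2 \<Rightarrow> 'a \<Rightarrow> ('k, 'a) tensor2"
  where "coprod r s a = left_act a r - right_act s a"

definition inner_coder :: "('k, 'a) tensor2 \<Rightarrow> 'a \<Rightarrow> ('k, 'a) tensor2"
  where "inner_coder r a = left_act a r - right_act r a"

text \<open>
  That \<open>(A, \<alpha>, \<mu>, coprod r s, inner_coder r, inner_coder s)\<close> is a quasitriangular covariant
  Hom-bialgebra.  The first conjunct is in fact a consequence of the second.
\<close>

definition quasitriangular :: "('k, 'a) tensor2 \<Rightarrow> ('k, 'a) tensor2 \<Rightarrow> bool"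
  where "quasitriangular r s \<longleftrightarrow>
    covariant_hom_bialgebra (coprod r s) (inner_coder r) (inner_coder s) \<and>
    hom_Yang_Baxter_pair r s"

subsection \<open>Maps on the dual space\<close>

abbreviation dual_sw2 :: "('k, 'a \<Rightarrow> 'k) tensor2 \<Rightarrow> (('a \<Rightarrow> 'k) \<Rightarrow> ('a \<Rightarrow> 'k) \<Rightarrow> 'u::ab_group_add) \<Rightarrow> 'u"
  where "dual_sw2 \<equiv> sweedler2 (dual scale) fscale"

text \<open>\<open>f \<otimes> g\<close> for linear maps \<open>f, g : A\<^sup>* \<rightarrow> A\<close>\<close>

definition dual_tensor_map ::
  "(('a \<Rightarrow> 'k) \<Rightarrow> 'a) \<Rightarrow> (('a \<Rightarrow> 'k) \<Rightarrow> 'a) \<Rightarrow> ('k, 'a \<Rightarrow> 'k) tensor2 \<Rightarrow> ('k, 'a) tensor2"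
  where "dual_tensor_map f g t = dual_sw2 t (\<lambda>\<phi> \<psi>. f \<phi> \<otimes> g \<psi>)"

text \<open>The pairing of \<open>A\<^sup>* \<otimes> A\<^sup>*\<close> with \<open>A \<otimes> A\<close>, and the map \<open>D\<^sup>* : A\<^sup>* \<otimes> A\<^sup>* \<rightarrow> A\<^sup>*\<close>\<close>

definition pairing2 :: "('k, 'a \<Rightarrow> 'k) tensor2 \<Rightarrow> ('k, 'a) tensor2 \<Rightarrow> 'k"
  where "pairing2 t u = dual_sw2 t (\<lambda>\<phi> \<psi>. sw2 u (\<lambda>x y. \<phi> x * \<psi> y))"

definition transpose :: "('a \<Rightarrow> ('k, 'a) tensor2) \<Rightarrow> ('k, 'a \<Rightarrow> 'k) tensor2 \<Rightarrow> 'a \<Rightarrow> 'k"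
  where "transpose D t = (\<lambda>a. pairing2 t (D a))"

definition rho1 :: "('k, 'a) tensor2 \<Rightarrow> ('a \<Rightarrow> 'k) \<Rightarrow> 'a"
  where "rho1 r \<phi> = sw2 r (\<lambda>r1 r2. \<phi> (\<alpha> r2) *s r1)"

definition rho2 :: "('k, 'a) tensor2 \<Rightarrow> ('a \<Rightarrow> 'k) \<Rightarrow> 'a"
  where "rho2 r \<phi> = sw2 r (\<lambda>r1 r2. \<phi> r2 *s \<alpha> r1)"

definition lambda1 :: "('k, 'a) tensor2 \<Rightarrow> ('a \<Rightarrow> 'k) \<Rightarrow> 'a"
  where "lambda1 s \<phi> = sw2 s (\<lambda>s1 s2. \<phi> (\<alpha> s1) *s s2)"

definition lambda2 :: "('k, 'a) tensor2 \<Rightarrow> ('a \<Rightarrow> 'k) \<Rightarrow> 'a"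
  where "lambda2 s \<phi> = sw2 s (\<lambda>s1 s2. \<phi> s1 *s \<alpha> s2)"

end

end

theory Submission
  imports Defs
begin

text \<open>
  Expanding \<open>\<triangle>'\<close> gives \<open>(\<alpha> \<otimes> \<triangle>')(r) = r\<^sub>1\<^sub>2 r\<^sub>2\<^sub>3 - s\<^sub>2\<^sub>3 r\<^sub>1\<^sub>3\<close> and \<open>(\<triangle>' \<otimes> \<alpha>)(s) = s\<^sub>1\<^sub>3 r\<^sub>1\<^sub>2 - s\<^sub>1\<^sub>2 s\<^sub>2\<^sub>3\<close>, so (ii) is a
  rewriting of the two Yang-Baxter equations.  These imply the coassociativity of \<open>\<triangle>'\<close>: acting with
  \<open>a\<close> from the left on the first equation and from the right on the second gives all terms of
  \<open>(\<triangle>' \<otimes> \<alpha>)\<triangle>'(a) = (\<alpha> \<otimes> \<triangle>')\<triangle>'(a)\<close> except a mixed one, which agrees on both sides by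
  Hom-associativity and invariance.  Condition (iii) says that the two sides of (ii) agree after
  pairing two of the three tensor factors with arbitrary functionals, and elements of
  \<open>A \<otimes> A \<otimes> A\<close> are separated by products of functionals, namely the coordinate functionals of a basis.
\<close>

section \<open>Sweedler sums and separation of tensors\<close>

text \<open>
  A Sweedler sum uses one fixed representation of its tensor, so it is additive in the summand without
  any bilinearity hypothesis; only linearity in the tensor needs a bilinear summand.
\<close>

lemma sweedler2_add:
  "sweedler2 V s t (\<lambda>x y. B x y + C x y) = sweedler2 V s t B + sweedler2 V s t C"
  by (simp add: sweedler2_def case_prod_unfold sum_list_addf)

lemma sweedler2_hom:
  assumes "\<And>x y. f (x + y) = f x + f y"
  shows "f (sweedler2 V s t B) = sweedler2 V s t (\<lambda>x y. f (B x y))"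
proof -
  have "f 0 = 0" using assms[of 0 0] by simp
  then have "f (\<Sum>(x, y)\<leftarrow>xs. B x y) = (\<Sum>(x, y)\<leftarrow>xs. f (B x y))" for xs
    by (induction xs) (auto simp: assms)
  then show ?thesis unfolding sweedler2_def .
qed

lemma sweedler2_uminus: "sweedler2 V s t (\<lambda>x y. - B x y) = - sweedler2 V s t B"
  by (rule sweedler2_hom[symmetric]) simp

lemma sweedler2_diff:
  "sweedler2 V s t (\<lambda>x y. B x y - C x y) = sweedler2 V s t B - sweedler2 V s t C"
  using sweedler2_add[of V s t B "\<lambda>x y. - C x y"] by (simp add: sweedler2_uminus)

lemma sweedler2_scale:
  assumes "vector_space s'"
  shows "sweedler2 V s t (\<lambda>x y. s' c (B x y)) = s' c (sweedler2 V s t B)"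
proof -
  interpret vector_space s' by fact
  show ?thesis by (rule sweedler2_hom[symmetric]) (rule scale_right_distrib)
qed

text \<open>An interchange of two finite sums: after \<open>t\<close> is replaced by its chosen
  list, additivity of the inner sum in its summand is enough, so \<open>B\<close> is arbitrary and
  the two tensors may live over different spaces.\<close>

lemma sweedler2_swap:
  "sweedler2 V s t (\<lambda>x y. sweedler2 W s' u (\<lambda>z w. B x y z w))
    = sweedler2 W s' u (\<lambda>z w. sweedler2 V s t (\<lambda>x y. B x y z w))"
proof -
  have "(\<Sum>(x, y)\<leftarrow>xs. sweedler2 W s' u (\<lambda>z w. B x y z w))
      = sweedler2 W s' u (\<lambda>z w. \<Sum>(x, y)\<leftarrow>xs. B x y z w)" for xs
    by (induction xs) (auto simp: sweedler2_add sweedler2_def case_prod_unfold)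
  then show ?thesis unfolding sweedler2_def[of V s t] .
qed

text \<open>Membership of \<open>t\<close> in the tensor space guarantees that the list behind
  \<open>SOME\<close> has its entries in \<open>V\<close>. This matters for \<open>V\<close> the
  dual, where summands need only agree on linear functionals.\<close>

lemma sweedler2_cong:
  assumes "vector_space s" "module.subspace s V" "t \<in> tensor2_space V s"
    and "\<And>x y. x \<in> V \<Longrightarrow> y \<in> V \<Longrightarrow> B x y = C x y"
  shows "sweedler2 V s t B = sweedler2 V s t C"
proof -
  let ?P = "\<lambda>xs. set xs \<subseteq> V \<times> V \<and> t = elem2_sum V s xs"
  have "\<exists>xs. ?P xs" using assms(3) unfolding tensor2_space_eq[OF assms(1,2)] by blast
  then have "set (Eps ?P) \<subseteq> V \<times> V" by (metis (mono_tags, lifting) someI_ex)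
  moreover have "(\<Sum>(x, y)\<leftarrow>xs. B x y) = (\<Sum>(x, y)\<leftarrow>xs. C x y)" if "set xs \<subseteq> V \<times> V" for xs
    using that by (induction xs) (auto simp: assms(4))
  ultimately show ?thesis unfolding sweedler2_def by blast
qed

section \<open>Membership in tensor powers, and linear maps applied to Sweedler sums\<close>

lemma elem2_in_tensor2_space:
  assumes "x \<in> V" "y \<in> V"
  shows "elem2 V s x y \<in> tensor2_space V s"
proof -
  interpret F: vector_space fscale by (rule vector_space_fscale)
  show ?thesis unfolding tensor2_space_def using assms by (intro F.span_base) blast
qed

lemma elem3_in_tensor3_space:
  assumes "x \<in> V" "y \<in> V" "z \<in> V"
  shows "elem3 V s x y z \<in> tensor3_space V s"
proof -
  interpret F: vector_space fscale by (rule vector_space_fscale)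
  show ?thesis unfolding tensor3_space_def using assms by (intro F.span_base) blast
qed

lemma subspace_tensor2_space: "module.subspace fscale (tensor2_space V s)"
proof -
  interpret F: vector_space fscale by (rule vector_space_fscale)
  show ?thesis unfolding tensor2_space_def by simp
qed

lemma subspace_tensor3_space: "module.subspace fscale (tensor3_space V s)"
proof -
  interpret F: vector_space fscale by (rule vector_space_fscale)
  show ?thesis unfolding tensor3_space_def by simp
qed

lemma sweedler2_mem:
  assumes "vector_space s'" "module.subspace s' U" "\<And>x y. B x y \<in> U"
  shows "sweedler2 V s t B \<in> U"
proof -
  interpret S: vector_space s' by fact
  have "(\<Sum>(x, y)\<leftarrow>xs. B x y) \<in> U" for xs
    using assms(2,3) by (induction xs) (auto simp: S.subspace_0 S.subspace_add)
  then show ?thesis unfolding sweedler2_def .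
qed

text \<open>Counterpart of \<open>sweedler2_hom\<close> for maps additive only on a subspace, such
  as the map on tensors induced by a bilinear or trilinear map. The partial sums have to stay inside
  \<open>U\<close>.\<close>

lemma sweedler2_linear_on_hom:
  assumes "vector_space s1" "module.subspace s1 U" "linear_on U s1 s2 f" "\<And>x y. B x y \<in> U"
  shows "f (sweedler2 V s t B) = sweedler2 V s t (\<lambda>x y. f (B x y))"
proof -
  interpret S: vector_space s1 by fact
  have add: "f (x + y) = f x + f y" if "x \<in> U" "y \<in> U" for x y
    using assms(3) that by (simp add: linear_on_def)
  have "0 \<in> U" using assms(2) by (rule S.subspace_0)
  then have "f 0 = 0" using add[of 0 0] by simp
  moreover have "(\<Sum>(x, y)\<leftarrow>xs. B x y) \<in> U" for xs
    using assms(2,4) by (induction xs) (auto simp: S.subspace_0 S.subspace_add)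
  ultimately have "f (\<Sum>(x, y)\<leftarrow>xs. B x y) = (\<Sum>(x, y)\<leftarrow>xs. f (B x y))" for xs
    by (induction xs) (auto simp: add assms(4))
  then show ?thesis unfolding sweedler2_def .
qed

lemma tensor2_diff_mem:
  assumes "t \<in> tensor2_space V s" "u \<in> tensor2_space V s"
  shows "t - u \<in> tensor2_space V s"
proof -
  interpret F: vector_space fscale by (rule vector_space_fscale)
  show ?thesis using subspace_tensor2_space assms by (rule F.subspace_diff)
qed

lemma linear_on_subspace_diff:
  assumes "vector_space s1" "module.subspace s1 U" "linear_on U s1 s2 f" "x \<in> U" "y \<in> U"
  shows "f (x - y) = f x - f y"
proof -
  interpret S: vector_space s1 by fact
  have "x - y \<in> U" using assms by (simp add: S.subspace_diff)
  then have "f (x - y + y) = f (x - y) + f y"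
    using assms(3,5) unfolding linear_on_def by blast
  then show ?thesis by simp
qed

text \<open>Evaluation at elementary tensors recovers \<open>B\<close> and \<open>C\<close>. This
  reduces the identities of maps in (iii) to identities for pairs of functionals.\<close>

lemma sweedler2_eq_iff:
  assumes "vector_space s" "module.subspace s V" "vector_space s'"
    and "bilinear_on V s s' B" "bilinear_on V s s' C"
  shows "(\<forall>t\<in>tensor2_space V s. sweedler2 V s t B = sweedler2 V s t C)
    \<longleftrightarrow> (\<forall>x\<in>V. \<forall>y\<in>V. B x y = C x y)"
  using sweedler2_cong[OF assms(1,2), of _ B C] elem2_in_tensor2_space
    sweedler2_elementary[OF assms(3,4)] sweedler2_elementary[OF assms(3,5)]
  by metis

section \<open>Separation of threefold tensors by products of functionals\<close>

lemma tensor3_eq_0I: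
  assumes "vector_space s" "t \<in> tensor3_space UNIV s"
    and "\<And>f g h. f \<in> dual s \<Longrightarrow> g \<in> dual s \<Longrightarrow> h \<in> dual s \<Longrightarrow> t (\<lambda>x y z. f x * g y * h z) = 0"
  shows "t = 0"
proof
  fix \<tau> :: "'b \<Rightarrow> 'b \<Rightarrow> 'b \<Rightarrow> 'a"
  interpret S: vector_space s by fact
  obtain xs where t: "t = elem3_sum UNIV s xs"
    using assms(2) tensor3_space_eq[OF assms(1) S.subspace_UNIV] by blast
  show "t \<tau> = 0 \<tau>"
  proof (cases "trilinear_on UNIV s (*) \<tau>")
    case False
    \<comment> \<open>At a form that is not trilinear every \<open>elem3\<close> takes its default
      value 0.\<close>
    have "elem3_sum UNIV s ys \<tau> = 0" for ys
    proof (induction ys)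
      case (Cons p ys)
      then show ?case
        by (cases p) (simp only: elem3_sum_simps plus_fun_apply elem3_def False if_False add_0)
    qed (simp add: elem3_sum_simps)
    then show ?thesis by (simp add: t)
  next
    case True
    obtain X where X: "S.independent X" "S.span X = UNIV"
      using S.maximal_independent_subset[of UNIV] by (metis top.extremum_unique)
    \<comment> \<open>\<open>\<rho> b\<close> is the coordinate functional of the basis vector
      \<open>b\<close>.\<close>
    define \<rho> where "\<rho> b x = S.representation X x b" for b x
    have dual: "\<rho> b \<in> dual s" for b
      using assms(1) X vector_space_mult
      by (simp add: dual_def Vector_Spaces.linear_iff \<rho>_def S.representation_add S.representation_scale)
    define supp where "supp x = {b. \<rho> b x \<noteq> 0}" for x
    have fin: "finite (supp x)" for x
      unfolding supp_def \<rho>_def by (rule S.finite_representation)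
    \<comment> \<open>The basis may be infinite, but only finitely many of its vectors occur in the
      chosen representation of \<open>t\<close>. They form one common index set for expanding all
      its entries.\<close>
    define F where "F = (\<Union>(x, y, z)\<in>set xs. supp x \<union> supp y \<union> supp z)"
    have "finite F" unfolding F_def by (auto simp: fin)
    have expand: "x = (\<Sum>b\<in>F. s (\<rho> b x) b)" if "supp x \<subseteq> F" for x
    proof -
      have "(\<Sum>b\<in>F. s (\<rho> b x) b) = (\<Sum>b\<in>supp x. s (\<rho> b x) b)"
        using \<open>finite F\<close> that by (intro sum.mono_neutral_right) (auto simp: supp_def)
      also have "\<dots> = x"
        using S.sum_nonzero_representation_eq[OF X(1), of x] X(2) by (simp add: supp_def \<rho>_def)
      finally show ?thesis ..
    qed
    have lin: "f (\<Sum>b\<in>F. s (c b) b) = (\<Sum>b\<in>F. c b * f b)" if "linear_on UNIV s (*) f" for f c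
    proof -
      have "f 0 = 0" using that unfolding linear_on_def by (metis UNIV_I add_0 add_cancel_left_left)
      with \<open>finite F\<close> that show ?thesis
        by (induction F) (auto simp: linear_on_def)
    qed
    have \<tau>: "\<tau> x y z = (\<Sum>b\<in>F. \<Sum>c\<in>F. \<Sum>d\<in>F. \<tau> b c d * (\<rho> b x * \<rho> c y * \<rho> d z))"
      if "(x, y, z) \<in> set xs" for x y z
    proof -
      have "supp x \<subseteq> F" "supp y \<subseteq> F" "supp z \<subseteq> F"
        unfolding F_def using that by blast+
      note e = this[THEN expand]
      have l: "linear_on UNIV s (*) (\<lambda>x. \<tau> x y z)" "linear_on UNIV s (*) (\<lambda>y. \<tau> x y z)"
        "linear_on UNIV s (*) (\<lambda>z. \<tau> x y z)" for x y z
        using True by (simp_all add: trilinear_on_def)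
      have "\<tau> x y z = (\<Sum>b\<in>F. \<rho> b x * \<tau> b y z)"
        by (subst e(1)) (rule lin[OF l(1)])
      also have "\<dots> = (\<Sum>b\<in>F. \<rho> b x * (\<Sum>c\<in>F. \<rho> c y * \<tau> b c z))"
        by (subst e(2), subst lin[OF l(2)]) (rule refl)
      also have "\<dots> = (\<Sum>b\<in>F. \<rho> b x * (\<Sum>c\<in>F. \<rho> c y * (\<Sum>d\<in>F. \<rho> d z * \<tau> b c d)))"
        by (subst e(3), subst lin[OF l(3)]) (rule refl)
      finally show ?thesis by (simp add: sum_distrib_left ac_simps)
    qed
    \<comment> \<open>The expansion is available only for triples in \<open>xs\<close>, hence the
      induction over lists with entries there. For \<open>xs\<close> itself the coefficient of
      \<open>\<tau> b c d\<close> is the value of \<open>t\<close> at a product of coordinate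
      functionals, which vanishes by hypothesis.\<close>
    have ys: "(\<Sum>(x, y, z)\<leftarrow>ys. \<tau> x y z)
        = (\<Sum>b\<in>F. \<Sum>c\<in>F. \<Sum>d\<in>F. \<tau> b c d * (\<Sum>(x, y, z)\<leftarrow>ys. \<rho> b x * \<rho> c y * \<rho> d z))"
      if "set ys \<subseteq> set xs" for ys
      using that
    proof (induction ys)
      case (Cons p ys)
      then show ?case by (cases p) (simp add: \<tau> sum.distrib distrib_left)
    qed simp
    have "t (\<lambda>x y z. \<rho> b x * \<rho> c y * \<rho> d z) = (\<Sum>(x, y, z)\<leftarrow>xs. \<rho> b x * \<rho> c y * \<rho> d z)" for b c d
      unfolding t using dual[of b] dual[of c] dual[of d]
      by (intro elem3_sum_apply)
        (simp add: trilinear_on_def linear_on_def dual_def Vector_Spaces.linear_iff algebra_simps)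
    with assms(3)[OF dual dual dual] have "(\<Sum>(x, y, z)\<leftarrow>xs. \<rho> b x * \<rho> c y * \<rho> d z) = 0" for b c d
      by simp
    then show ?thesis
      using ys[of xs] by (simp add: t elem3_sum_apply[OF True])
  qed
qed

lemma sweedler3_hom:
  assumes "\<And>x y. f (x + y) = f x + f y"
  shows "f (sweedler3 V s t B) = sweedler3 V s t (\<lambda>x y z. f (B x y z))"
proof -
  have "f 0 = 0" using assms[of 0 0] by simp
  then have "f (\<Sum>(x, y, z)\<leftarrow>xs. B x y z) = (\<Sum>(x, y, z)\<leftarrow>xs. f (B x y z))" for xs
    by (induction xs) (auto simp: assms)
  then show ?thesis unfolding sweedler3_def .
qed

text \<open>A tensor is encoded as a function of forms. Evaluation at \<open>\<tau>\<close> is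
  linear and correct on elementary tensors, so the universal property identifies it with the
  Sweedler sum.\<close>

lemma sweedler3_eq_apply:
  assumes "vector_space s" "module.subspace s V" "t \<in> tensor3_space V s" "trilinear_on V s (*) \<tau>"
  shows "sweedler3 V s t \<tau> = t \<tau>"
  by (rule sweedler3_unique[OF assms(1,2) vector_space_mult assms(4) _ _ assms(3),
        where f = "\<lambda>t. t \<tau>", symmetric])
    (simp_all add: linear_on_def fscale_def elem3_def assms(4))

lemma tensor3_eqI:
  assumes "vector_space s" "t \<in> tensor3_space UNIV s" "u \<in> tensor3_space UNIV s"
    and eq: "\<And>f g h. f \<in> dual s \<Longrightarrow> g \<in> dual s \<Longrightarrow> h \<in> dual s \<Longrightarrow>
      sweedler3 UNIV s t (\<lambda>x y z. f x * g y * h z) = sweedler3 UNIV s u (\<lambda>x y z. f x * g y * h z)"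
  shows "t = u"
proof -
  interpret S: vector_space s by fact
  interpret F: vector_space fscale by (rule vector_space_fscale)
  have "t - u = 0"
  proof (rule tensor3_eq_0I[OF assms(1)])
    show "t - u \<in> tensor3_space UNIV s"
      using subspace_tensor3_space assms(2,3) by (rule F.subspace_diff)
    fix f g h assume fgh: "f \<in> dual s" "g \<in> dual s" "h \<in> dual s"
    then have "trilinear_on UNIV s (*) (\<lambda>x y z. f x * g y * h z)"
      by (simp add: trilinear_on_def linear_on_def dual_def Vector_Spaces.linear_iff algebra_simps)
    from sweedler3_eq_apply[OF assms(1) S.subspace_UNIV _ this] eq[OF fgh]
    show "(t - u) (\<lambda>x y z. f x * g y * h z) = 0"
      using assms(2,3) by simp
  qed
  then show ?thesis by simp
qed

section \<open>Covariant Hom-bialgebras from Yang-Baxter pairs\<close>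

context hom_assoc_algebra
begin

section \<open>Multilinearity of the structure maps\<close>

lemma \<alpha>_add: "\<alpha> (x + y) = \<alpha> x + \<alpha> y" and \<alpha>_scale: "\<alpha> (c *s x) = c *s \<alpha> x"
  using linear_\<alpha> by (simp_all add: Vector_Spaces.linear_iff)

lemma mult_add_left: "(x + y) \<cdot> z = x \<cdot> z + y \<cdot> z"
  and mult_add_right: "x \<cdot> (y + z) = x \<cdot> y + x \<cdot> z"
  and mult_scale_left: "(c *s x) \<cdot> y = c *s (x \<cdot> y)"
  and mult_scale_right: "x \<cdot> (c *s y) = c *s (x \<cdot> y)"
  using bilinear_\<mu> by (simp_all add: bilinear_on_def linear_on_def)

lemma tensor_linear:
  "(x + x') \<otimes> y = (x \<otimes> y) + (x' \<otimes> y)" "x \<otimes> (y + y') = (x \<otimes> y) + (x \<otimes> y')"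
  "(c *s x) \<otimes> y = fscale c (x \<otimes> y)" "x \<otimes> (c *s y) = fscale c (x \<otimes> y)"
  using bilinear_on_elem2[of UNIV scale] by (simp_all add: bilinear_on_def linear_on_def)

lemma tensor'_linear:
  "(x + x') \<otimes> y \<otimes> z = (x \<otimes> y \<otimes> z) + (x' \<otimes> y \<otimes> z)"
  "x \<otimes> (y + y') \<otimes> z = (x \<otimes> y \<otimes> z) + (x \<otimes> y' \<otimes> z)"
  "x \<otimes> y \<otimes> (z + z') = (x \<otimes> y \<otimes> z) + (x \<otimes> y \<otimes> z')"
  "(c *s x) \<otimes> y \<otimes> z = fscale c (x \<otimes> y \<otimes> z)"
  "x \<otimes> (c *s y) \<otimes> z = fscale c (x \<otimes> y \<otimes> z)"
  "x \<otimes> y \<otimes> (c *s z) = fscale c (x \<otimes> y \<otimes> z)"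
  using trilinear_on_elem3[of UNIV scale] by (simp_all add: trilinear_on_def linear_on_def)

lemma fscale_linear:
  "fscale c (f + g) = fscale c f + fscale c g" "fscale c (f - g) = fscale c f - fscale c g"
  by (simp_all add: fscale_def fun_eq_iff algebra_simps)

text \<open>The three instances of \<open>sweedler2_scale\<close> serve sums with values in tensors,
  in the algebra and in the field, so that nested Sweedler sums are recognised as multilinear
  too.\<close>

lemmas linear_simps = \<alpha>_add \<alpha>_scale mult_add_left mult_add_right mult_scale_left mult_scale_right
  tensor_linear tensor'_linear fscale_linear scale_right_distrib scale_left_distrib
  sweedler2_add sweedler2_diff sweedler2_uminus
  sweedler2_scale[OF vector_space_fscale] sweedler2_scale[OF vector_space_axioms]
  sweedler2_scale[OF vector_space_mult]

lemma bilinear_onI: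
  assumes "\<And>x x' y. B (x + x') y = B x y + B x' y" "\<And>x y y'. B x (y + y') = B x y + B x y'"
    and "\<And>c x y. B (c *s x) y = s' c (B x y)" "\<And>c x y. B x (c *s y) = s' c (B x y)"
  shows "bilinear_on UNIV scale s' B"
  using assms by (simp add: bilinear_on_def linear_on_def)

lemma trilinear_onI:
  assumes "\<And>x x' y z. B (x + x') y z = B x y z + B x' y z"
    "\<And>x y y' z. B x (y + y') z = B x y z + B x y' z"
    "\<And>x y z z'. B x y (z + z') = B x y z + B x y z'"
    and "\<And>c x y z. B (c *s x) y z = s' c (B x y z)" "\<And>c x y z. B x (c *s y) z = s' c (B x y z)"
    "\<And>c x y z. B x y (c *s z) = s' c (B x y z)"
  shows "trilinear_on UNIV scale s' B"
  using assms by (simp add: trilinear_on_def linear_on_def)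

section \<open>Nested Sweedler sums\<close>

lemma tensor_mem: "x \<otimes> y \<in> tensor2_space UNIV scale"
  by (rule elem2_in_tensor2_space) simp_all

lemma tensor'_mem: "x \<otimes> y \<otimes> z \<in> tensor3_space UNIV scale"
  by (rule elem3_in_tensor3_space) simp_all

lemmas sweedler2_mem2 = sweedler2_mem[OF vector_space_fscale subspace_tensor2_space]
lemmas sweedler2_mem3 = sweedler2_mem[OF vector_space_fscale subspace_tensor3_space]

lemma left_act_mem: "left_act a p \<in> tensor2_space UNIV scale"
  and right_act_mem: "right_act p a \<in> tensor2_space UNIV scale"
  unfolding left_act_def right_act_def by (intro sweedler2_mem2 tensor_mem)+

lemma coprod_mem: "coprod p q a \<in> tensor2_space UNIV scale"
  unfolding coprod_def by (intro tensor2_diff_mem left_act_mem right_act_mem)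

text \<open>The map induced by \<open>C\<close> is linear on the tensor space, so it can be pulled
  into a sum of tensors lying there.\<close>

lemma sw2_sw2:
  assumes "vector_space s'" "bilinear_on UNIV scale s' C"
    and "\<And>x y. B x y \<in> tensor2_space UNIV scale"
  shows "sw2 (sweedler2 V s t B) C = sweedler2 V s t (\<lambda>x y. sw2 (B x y) C)"
  by (rule sweedler2_linear_on_hom[OF vector_space_fscale subspace_tensor2_space
        sweedler2_linear[OF vector_space_axioms subspace_UNIV assms(1,2)] assms(3)])

lemma sw3_sw2:
  assumes "vector_space s'" "trilinear_on UNIV scale s' C"
    and "\<And>x y. B x y \<in> tensor3_space UNIV scale"
  shows "sw3 (sweedler2 V s t B) C = sweedler2 V s t (\<lambda>x y. sw3 (B x y) C)"
  by (rule sweedler2_linear_on_hom[OF vector_space_fscale subspace_tensor3_space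
        sweedler3_linear[OF vector_space_axioms subspace_UNIV assms(1,2)] assms(3)])

text \<open>Keeping \<open>p\<close> and \<open>q\<close> independent lets one rule treat
  \<triangle>' and, for \<open>p\<close> equal to \<open>q\<close>, the inner coderivations.\<close>

lemma sw2_coprod:
  assumes "vector_space s'" "bilinear_on UNIV scale s' C"
  shows "sw2 (coprod p q a) C
    = sw2 p (\<lambda>x y. C (a \<cdot> x) (\<alpha> y)) - sw2 q (\<lambda>x y. C (\<alpha> x) (y \<cdot> a))"
proof -
  have "sw2 (coprod p q a) C = sw2 (left_act a p) C - sw2 (right_act q a) C"
    unfolding coprod_def
    by (rule linear_on_subspace_diff[OF vector_space_fscale subspace_tensor2_space
          sweedler2_linear[OF vector_space_axioms subspace_UNIV assms] left_act_mem right_act_mem])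
  then show ?thesis
    by (simp add: left_act_def right_act_def sw2_sw2[OF assms] tensor_mem
        sweedler2_elementary[OF assms])
qed

text \<open>Replacing \<open>t\<close> by its image under \<alpha> \<otimes> \<alpha> adds or
  removes one \<alpha> on both factors. This balances the powers of \<alpha> produced by
  Hom-associativity and multiplicativity.\<close>

lemma sw2_invariant:
  assumes "t \<in> tensor2_space UNIV scale" "invariant t" "vector_space s'" "bilinear_on UNIV scale s' C"
  shows "sw2 t (\<lambda>x y. C (\<alpha> x) (\<alpha> y)) = sw2 t C"
proof -
  have "sw2 t C = sw2 (sw2 t (\<lambda>x y. \<alpha> x \<otimes> \<alpha> y)) C"
    using assms(2) by (simp add: invariant_def \<alpha>_\<alpha>_def)
  also have "\<dots> = sw2 t (\<lambda>x y. C (\<alpha> x) (\<alpha> y))"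
    by (simp add: sw2_sw2[OF assms(3,4)] tensor_mem sweedler2_elementary[OF assms(3,4)])
  finally show ?thesis ..
qed

lemma coprod_add: "coprod p q (a + b) = coprod p q a + coprod p q b"
  and coprod_scale: "coprod p q (c *s a) = fscale c (coprod p q a)"
  by (simp_all add: coprod_def left_act_def right_act_def linear_simps)

lemma sw3_sw2_sw2:
  assumes "trilinear_on UNIV scale fscale C" "\<And>x y z w. B x y z w \<in> tensor3_space UNIV scale"
  shows "sw3 (sweedler2 V s t (\<lambda>x y. sw2 (u x y) (B x y))) C
    = sweedler2 V s t (\<lambda>x y. sw2 (u x y) (\<lambda>z w. sw3 (B x y z w) C))"
  by (simp add: sw3_sw2[OF vector_space_fscale assms(1)] assms(2) sweedler2_mem3)

section \<open>Expansion of \<alpha> \<otimes> \<triangle>' and \<triangle>' \<otimes>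
  \<alpha>\<close>

lemma \<alpha>_map_coprod:
  "\<alpha>_map (coprod p q) t
    = sw2 t (\<lambda>a b. sw2 p (\<lambda>x y. \<alpha> a \<otimes> (b \<cdot> x) \<otimes> \<alpha> y) - sw2 q (\<lambda>x y. \<alpha> a \<otimes> \<alpha> x \<otimes> (y \<cdot> b)))"
  unfolding \<alpha>_map_def
  by (subst sw2_coprod[OF vector_space_fscale])
    (auto intro!: bilinear_onI simp: linear_simps)

lemma map_\<alpha>_coprod:
  "map_\<alpha> (coprod p q) t
    = sw2 t (\<lambda>a b. sw2 p (\<lambda>x y. (a \<cdot> x) \<otimes> \<alpha> y \<otimes> \<alpha> b) - sw2 q (\<lambda>x y. \<alpha> x \<otimes> (y \<cdot> a) \<otimes> \<alpha> b))"
  unfolding map_\<alpha>_def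
  by (subst sw2_coprod[OF vector_space_fscale])
    (auto intro!: bilinear_onI simp: linear_simps)

text \<open>The terms are the Yang-Baxter products already, except that in the second one the sums
  over \<open>r\<close> and \<open>s\<close> are nested in the opposite order.\<close>

lemma \<alpha>_map_coprod_prod: "\<alpha>_map (coprod r s) r = prod_12_23 r r - prod_23_13 s r"
  unfolding \<alpha>_map_coprod prod_12_23_def prod_23_13_def
  by (simp add: sweedler2_diff sweedler2_swap[where t = s and u = r])

lemma map_\<alpha>_coprod_prod: "map_\<alpha> (coprod r s) s = prod_13_12 s r - prod_12_23 s s"
  unfolding map_\<alpha>_coprod prod_12_23_def prod_13_12_def
  by (simp add: sweedler2_diff)
    (rule sweedler2_swap[where B = "\<lambda>a b x y. \<alpha> x \<otimes> (y \<cdot> a) \<otimes> \<alpha> b"])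

section \<open>The bialgebra axioms other than coassociativity\<close>

lemma comm_map_coprod:
  assumes p: "p \<in> tensor2_space UNIV scale" "invariant p"
    and q: "q \<in> tensor2_space UNIV scale" "invariant q"
  shows "comm_map (coprod p q)"
  unfolding comm_map_def
proof (intro conjI allI)
  show "Vector_Spaces.linear scale fscale (coprod p q)"
    by (simp add: Vector_Spaces.linear_iff vector_space_axioms vector_space_fscale coprod_add
        coprod_scale)
  show "range (coprod p q) \<subseteq> tensor2_space UNIV scale"
    by (auto simp: coprod_mem)
  fix a
  have "\<alpha>_\<alpha> (coprod p q a) = sw2 p (\<lambda>x y. \<alpha> (a \<cdot> x) \<otimes> \<alpha> (\<alpha> y)) - sw2 q (\<lambda>x y. \<alpha> (\<alpha> x) \<otimes> \<alpha> (y \<cdot> a))"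
    unfolding \<alpha>_\<alpha>_def
    by (rule sw2_coprod[OF vector_space_fscale]) (auto intro!: bilinear_onI simp: linear_simps)
  \<comment> \<open>Multiplicativity moves \<alpha> onto each factor of \<open>p\<close> and
    \<open>q\<close>, where invariance absorbs it.\<close>
  also have "\<dots> = sw2 p (\<lambda>x y. (\<alpha> a \<cdot> x) \<otimes> \<alpha> y) - sw2 q (\<lambda>x y. \<alpha> x \<otimes> (y \<cdot> \<alpha> a))"
    unfolding multiplicative
    by (rule arg_cong2[where f = minus];
        rule sw2_invariant[OF _ _ vector_space_fscale, where C = "\<lambda>x y. (\<alpha> a \<cdot> x) \<otimes> \<alpha> y"]
          sw2_invariant[OF _ _ vector_space_fscale, where C = "\<lambda>x y. \<alpha> x \<otimes> (y \<cdot> \<alpha> a)"];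
        auto intro!: bilinear_onI simp: linear_simps p q)
  finally show "\<alpha>_\<alpha> (coprod p q a) = coprod p q (\<alpha> a)"
    by (simp add: coprod_def left_act_def right_act_def)
qed

lemma \<mu>_\<alpha>_\<alpha>_map:
  "\<mu>_\<alpha> (\<alpha>_map D t) = sw2 t (\<lambda>a b. sw2 (D b) (\<lambda>x y. (\<alpha> a \<cdot> x) \<otimes> \<alpha> y))"
proof -
  have "trilinear_on UNIV scale fscale (\<lambda>a b c. (a \<cdot> b) \<otimes> \<alpha> c)"
    by (rule trilinear_onI) (simp_all add: linear_simps)
  then show ?thesis
    unfolding \<mu>_\<alpha>_def \<alpha>_map_def
    by (simp add: sw3_sw2_sw2 tensor'_mem sweedler3_elementary[OF vector_space_fscale])
qed

lemma \<alpha>_\<mu>_map_\<alpha>: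
  "\<alpha>_\<mu> (map_\<alpha> D t) = sw2 t (\<lambda>a b. sw2 (D a) (\<lambda>x y. \<alpha> x \<otimes> (y \<cdot> \<alpha> b)))"
proof -
  have "trilinear_on UNIV scale fscale (\<lambda>a b c. \<alpha> a \<otimes> (b \<cdot> c))"
    by (rule trilinear_onI) (simp_all add: linear_simps)
  then show ?thesis
    unfolding \<alpha>_\<mu>_def map_\<alpha>_def
    by (simp add: sw3_sw2_sw2 tensor'_mem sweedler3_elementary[OF vector_space_fscale])
qed

text \<open>
  The terms containing \<open>u\<close> cancel, so that this covers the compatibility conditions of
  \<open>\<triangle>'\<close>, \<open>\<delta>\<^sub>r\<close> and \<open>\<delta>\<^sub>s\<close> with the multiplication all at once.
\<close>

lemma coprod_mult_map:
  assumes p: "p \<in> tensor2_space UNIV scale" "invariant p"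
    and q: "q \<in> tensor2_space UNIV scale" "invariant q"
  shows "coprod p q (mult_map t) = \<mu>_\<alpha> (\<alpha>_map (coprod p u) t) + \<alpha>_\<mu> (map_\<alpha> (coprod u q) t)"
proof -
  have "coprod p q (a \<cdot> b)
    = sw2 (coprod p u b) (\<lambda>x y. (\<alpha> a \<cdot> x) \<otimes> \<alpha> y) + sw2 (coprod u q a) (\<lambda>x y. \<alpha> x \<otimes> (y \<cdot> \<alpha> b))" for a b
  proof -
    have 1: "sw2 (coprod p u b) (\<lambda>x y. (\<alpha> a \<cdot> x) \<otimes> \<alpha> y)
      = sw2 p (\<lambda>x y. (\<alpha> a \<cdot> (b \<cdot> x)) \<otimes> \<alpha> (\<alpha> y)) - sw2 u (\<lambda>x y. (\<alpha> a \<cdot> \<alpha> x) \<otimes> \<alpha> (y \<cdot> b))"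
      by (rule sw2_coprod[OF vector_space_fscale]) (auto intro!: bilinear_onI simp: linear_simps)
    have 2: "sw2 (coprod u q a) (\<lambda>x y. \<alpha> x \<otimes> (y \<cdot> \<alpha> b))
      = sw2 u (\<lambda>x y. \<alpha> (a \<cdot> x) \<otimes> (\<alpha> y \<cdot> \<alpha> b)) - sw2 q (\<lambda>x y. \<alpha> (\<alpha> x) \<otimes> ((y \<cdot> a) \<cdot> \<alpha> b))"
      by (rule sw2_coprod[OF vector_space_fscale]) (auto intro!: bilinear_onI simp: linear_simps)
    \<comment> \<open>Hom-associativity shifts \<alpha> from \<open>a\<close> to \<open>x\<close>,
      leaving an extra \<alpha> on both factors of \<open>p\<close>, which invariance removes. Fact
      \<open>4\<close> is the mirror image for \<open>q\<close>.\<close>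
    have 3: "sw2 p (\<lambda>x y. (\<alpha> a \<cdot> (b \<cdot> x)) \<otimes> \<alpha> (\<alpha> y)) = sw2 p (\<lambda>x y. ((a \<cdot> b) \<cdot> x) \<otimes> \<alpha> y)"
      unfolding hom_assoc[symmetric]
      by (rule sw2_invariant[OF p vector_space_fscale, where C = "\<lambda>x y. ((a \<cdot> b) \<cdot> x) \<otimes> \<alpha> y"])
        (auto intro!: bilinear_onI simp: linear_simps)
    have 4: "sw2 q (\<lambda>x y. \<alpha> (\<alpha> x) \<otimes> ((y \<cdot> a) \<cdot> \<alpha> b)) = sw2 q (\<lambda>x y. \<alpha> x \<otimes> (y \<cdot> (a \<cdot> b)))"
      unfolding hom_assoc
      by (rule sw2_invariant[OF q vector_space_fscale, where C = "\<lambda>x y. \<alpha> x \<otimes> (y \<cdot> (a \<cdot> b))"])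
        (auto intro!: bilinear_onI simp: linear_simps)
    show ?thesis
      unfolding 1 2 3 4 by (simp add: coprod_def left_act_def right_act_def multiplicative)
  qed
  moreover have "coprod p q (mult_map t) = sw2 t (\<lambda>a b. coprod p q (a \<cdot> b))"
    unfolding mult_map_def by (rule sweedler2_hom) (rule coprod_add)
  ultimately show ?thesis by (simp add: \<mu>_\<alpha>_\<alpha>_map \<alpha>_\<mu>_map_\<alpha> sweedler2_add)
qed

section \<open>Coassociativity from the Yang-Baxter equations\<close>

lemma prod_mem:
  "prod_13_12 p q \<in> tensor3_space UNIV scale" "prod_12_23 p q \<in> tensor3_space UNIV scale"
  "prod_23_13 p q \<in> tensor3_space UNIV scale"
  unfolding prod_13_12_def prod_12_23_def prod_23_13_def
  by (intro sweedler2_mem3 tensor'_mem)+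

lemma sw3_prod:
  assumes "vector_space s'" "trilinear_on UNIV scale s' C"
  shows "sw3 (prod_13_12 p q) C = sw2 p (\<lambda>x y. sw2 q (\<lambda>z w. C (x \<cdot> z) (\<alpha> w) (\<alpha> y)))"
    and "sw3 (prod_12_23 p q) C = sw2 p (\<lambda>x y. sw2 q (\<lambda>z w. C (\<alpha> x) (y \<cdot> z) (\<alpha> w)))"
    and "sw3 (prod_23_13 p q) C = sw2 p (\<lambda>x y. sw2 q (\<lambda>z w. C (\<alpha> z) (\<alpha> x) (y \<cdot> w)))"
  unfolding prod_13_12_def prod_12_23_def prod_23_13_def
  by (simp_all add: sw3_sw2[OF assms] tensor'_mem sweedler2_mem3 sweedler3_elementary[OF assms])

lemma sw3_diff:
  assumes "vector_space s'" "trilinear_on UNIV scale s' C"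
    "t \<in> tensor3_space UNIV scale" "u \<in> tensor3_space UNIV scale"
  shows "sw3 (t - u) C = sw3 t C - sw3 u C"
  by (rule linear_on_subspace_diff[OF vector_space_fscale subspace_tensor3_space
        sweedler3_linear[OF vector_space_axioms subspace_UNIV assms(1,2)] assms(3,4)])

lemma coassociative_coprod:
  assumes r: "r \<in> tensor2_space UNIV scale" "invariant r"
    and s: "s \<in> tensor2_space UNIV scale" "invariant s"
    and r_eq: "prod_13_12 r r = prod_12_23 r r - prod_23_13 s r"
    and s_eq: "prod_13_12 s r - prod_12_23 s s = - prod_23_13 s s"
  shows "map_\<alpha> (coprod r s) (coprod r s a) = \<alpha>_map (coprod r s) (coprod r s a)"
proof -
  note inv_r = sw2_invariant[OF r vector_space_fscale]
    and inv_s = sw2_invariant[OF s vector_space_fscale]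
  \<comment> \<open>The \<open>?M\<close> terms expand (\<triangle>' \<otimes>
    \<alpha>)\<triangle>'(a) and the \<open>?N\<close> terms (\<alpha> \<otimes>
    \<triangle>')\<triangle>'(a). In both families the outer sum runs over \<open>r\<close> in the
    first two terms and over \<open>s\<close> in the last two.\<close>
  let ?M1 = "sw2 r (\<lambda>p q. sw2 r (\<lambda>x y. ((a \<cdot> p) \<cdot> x) \<otimes> \<alpha> y \<otimes> \<alpha> (\<alpha> q)))"
  let ?M2 = "sw2 r (\<lambda>p q. sw2 s (\<lambda>x y. \<alpha> x \<otimes> (y \<cdot> (a \<cdot> p)) \<otimes> \<alpha> (\<alpha> q)))"
  let ?M3 = "sw2 s (\<lambda>p q. sw2 r (\<lambda>x y. (\<alpha> p \<cdot> x) \<otimes> \<alpha> y \<otimes> \<alpha> (q \<cdot> a)))"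
  let ?M4 = "sw2 s (\<lambda>p q. sw2 s (\<lambda>x y. \<alpha> x \<otimes> (y \<cdot> \<alpha> p) \<otimes> \<alpha> (q \<cdot> a)))"
  let ?N1 = "sw2 r (\<lambda>p q. sw2 r (\<lambda>x y. \<alpha> (a \<cdot> p) \<otimes> (\<alpha> q \<cdot> x) \<otimes> \<alpha> y))"
  let ?N2 = "sw2 r (\<lambda>p q. sw2 s (\<lambda>x y. \<alpha> (a \<cdot> p) \<otimes> \<alpha> x \<otimes> (y \<cdot> \<alpha> q)))"
  let ?N3 = "sw2 s (\<lambda>p q. sw2 r (\<lambda>x y. \<alpha> (\<alpha> p) \<otimes> ((q \<cdot> a) \<cdot> x) \<otimes> \<alpha> y))"
  let ?N4 = "sw2 s (\<lambda>p q. sw2 s (\<lambda>x y. \<alpha> (\<alpha> p) \<otimes> \<alpha> x \<otimes> (y \<cdot> (q \<cdot> a))))"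
  have M: "map_\<alpha> (coprod r s) (coprod r s a) = ?M1 - ?M2 - (?M3 - ?M4)"
    unfolding map_\<alpha>_coprod
    by (subst sw2_coprod[OF vector_space_fscale])
      (auto intro!: bilinear_onI simp: linear_simps)
  have N: "\<alpha>_map (coprod r s) (coprod r s a) = ?N1 - ?N2 - (?N3 - ?N4)"
    unfolding \<alpha>_map_coprod
    by (subst sw2_coprod[OF vector_space_fscale])
      (auto intro!: bilinear_onI simp: linear_simps)
  \<comment> \<open>Invariance of \<open>s\<close> supplies the \<alpha> that Hom-associativity
    moves onto \<open>p\<close>; invariance of \<open>r\<close> then removes it.\<close>
  have M2: "?M2 = ?N3"
  proof -
    have "?M2 = sw2 r (\<lambda>p q. sw2 s (\<lambda>x y. \<alpha> (\<alpha> x) \<otimes> ((y \<cdot> a) \<cdot> \<alpha> p) \<otimes> \<alpha> (\<alpha> q)))"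
      unfolding hom_assoc
      by (subst inv_s[where C = "\<lambda>x y. \<alpha> x \<otimes> (y \<cdot> (a \<cdot> _)) \<otimes> \<alpha> (\<alpha> _)"])
        (auto intro!: bilinear_onI simp: linear_simps)
    also have "\<dots> = sw2 r (\<lambda>p q. sw2 s (\<lambda>x y. \<alpha> (\<alpha> x) \<otimes> ((y \<cdot> a) \<cdot> p) \<otimes> \<alpha> q))"
      by (rule inv_r[where C = "\<lambda>p q. sw2 s (\<lambda>x y. \<alpha> (\<alpha> x) \<otimes> ((y \<cdot> a) \<cdot> p) \<otimes> \<alpha> q)"])
        (auto intro!: bilinear_onI simp: linear_simps)
    also have "\<dots> = ?N3" by (rule sweedler2_swap)
    finally show ?thesis .
  qed
  have M1: "?M1 = ?N1 - ?N2"
  proof -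
    \<comment> \<open>\<open>?L\<close> is the left action on threefold tensors, applied to
      \<open>r_eq\<close>. It multiplies by \<open>\<alpha> a\<close> rather than \<open>a\<close>
      so that Hom-associativity applies to the product in the first factor. Each of the three terms
      needs one use of invariance to reach its \<open>?M\<close> or \<open>?N\<close> form.\<close>
    let ?L = "\<lambda>x y z. (\<alpha> a \<cdot> x) \<otimes> \<alpha> y \<otimes> \<alpha> z"
    have L: "trilinear_on UNIV scale fscale ?L"
      by (rule trilinear_onI) (simp_all add: linear_simps)
    note L_prod = sw3_prod[OF vector_space_fscale L]
    have "sw3 (prod_13_12 r r) ?L = ?M1"
      unfolding L_prod hom_assoc[symmetric]
      by (subst inv_r[where C = "\<lambda>x y. ((a \<cdot> _) \<cdot> x) \<otimes> \<alpha> y \<otimes> \<alpha> (\<alpha> _)"])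
        (auto intro!: bilinear_onI simp: linear_simps)
    moreover have "sw3 (prod_12_23 r r) ?L = ?N1"
      unfolding L_prod multiplicative
      by (subst inv_r[where C = "\<lambda>x y. (\<alpha> a \<cdot> \<alpha> _) \<otimes> (\<alpha> _ \<cdot> x) \<otimes> \<alpha> y"])
        (auto intro!: bilinear_onI simp: linear_simps)
    moreover have "sw3 (prod_23_13 s r) ?L = ?N2"
      unfolding L_prod multiplicative
      by (subst inv_s[where C = "\<lambda>p q. sw2 r (\<lambda>x y. (\<alpha> a \<cdot> \<alpha> x) \<otimes> \<alpha> p \<otimes> (q \<cdot> \<alpha> y))"])
        (auto intro!: bilinear_onI sweedler2_swap simp: linear_simps)
    ultimately show ?thesis
      using sw3_diff[OF vector_space_fscale L prod_mem(2,3)] r_eq by metis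
  qed
  have M4: "?M4 - ?M3 = ?N4"
  proof -
    \<comment> \<open>The right action of \<open>\<alpha> a\<close>, applied to \<open>s_eq\<close>
      in the same manner; here Hom-associativity acts in the last factor.\<close>
    let ?R = "\<lambda>x y z. \<alpha> x \<otimes> \<alpha> y \<otimes> (z \<cdot> \<alpha> a)"
    have R: "trilinear_on UNIV scale fscale ?R"
      by (rule trilinear_onI) (simp_all add: linear_simps)
    note R_prod = sw3_prod[OF vector_space_fscale R]
    have "sw3 (prod_13_12 s r) ?R = ?M3"
      unfolding R_prod multiplicative
      by (subst inv_r[where C = "\<lambda>x y. (\<alpha> _ \<cdot> x) \<otimes> \<alpha> y \<otimes> (\<alpha> _ \<cdot> \<alpha> a)"])
        (auto intro!: bilinear_onI simp: linear_simps)
    moreover have "sw3 (prod_12_23 s s) ?R = ?M4"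
      unfolding R_prod multiplicative
      by (subst inv_s[where C = "\<lambda>p q. sw2 s (\<lambda>x y. \<alpha> p \<otimes> (q \<cdot> \<alpha> x) \<otimes> (\<alpha> y \<cdot> \<alpha> a))"])
        (auto intro!: bilinear_onI sweedler2_swap simp: linear_simps)
    moreover have "sw3 (prod_23_13 s s) ?R = ?N4"
      unfolding R_prod hom_assoc
      by (subst inv_s[where C = "\<lambda>p q. sw2 s (\<lambda>x y. \<alpha> (\<alpha> x) \<otimes> \<alpha> p \<otimes> (q \<cdot> (y \<cdot> a)))"])
        (auto intro!: bilinear_onI sweedler2_swap simp: linear_simps)
    moreover have "prod_23_13 s s = prod_12_23 s s - prod_13_12 s r"
      using s_eq by (simp add: algebra_simps)
    ultimately show ?thesis
      using sw3_diff[OF vector_space_fscale R prod_mem(2,1)] by metis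
  qed
  have "map_\<alpha> (coprod r s) (coprod r s a) = ?M1 - ?M2 + (?M4 - ?M3)"
    unfolding M by simp
  then show ?thesis unfolding M1 M2 M4 N by simp
qed

section \<open>Equivalence of (i) and (ii)\<close>

lemma hom_Yang_Baxter_pair_iff:
  assumes "r \<in> tensor2_space UNIV scale" "invariant r" "s \<in> tensor2_space UNIV scale" "invariant s"
  shows "hom_Yang_Baxter_pair r s \<longleftrightarrow>
    \<alpha>_map (coprod r s) r = prod_13_12 r r \<and> map_\<alpha> (coprod r s) s = - prod_23_13 s s"
  unfolding hom_Yang_Baxter_pair_def \<alpha>_map_coprod_prod map_\<alpha>_coprod_prod
  using assms by (auto simp: algebra_simps eq_neg_iff_add_eq_0)

text \<open>Since \<open>quasitriangular\<close> includes the bialgebra axioms, the direction from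
  (ii) has to derive them; the converse reads off the Yang-Baxter equations.\<close>

lemma quasitriangular_iff:
  assumes "r \<in> tensor2_space UNIV scale" "invariant r" "s \<in> tensor2_space UNIV scale" "invariant s"
  shows "quasitriangular r s \<longleftrightarrow>
    \<alpha>_map (coprod r s) r = prod_13_12 r r \<and> map_\<alpha> (coprod r s) s = - prod_23_13 s s"
proof -
  have "covariant_hom_bialgebra (coprod r s) (inner_coder r) (inner_coder s)"
    if "\<alpha>_map (coprod r s) r = prod_13_12 r r" "map_\<alpha> (coprod r s) s = - prod_23_13 s s"
  proof -
    \<comment> \<open>This makes the facts about \<open>coprod p q\<close> apply to both
      coderivations.\<close>
    have "inner_coder p = coprod p p" for p
      by (simp add: inner_coder_def coprod_def fun_eq_iff)
    moreover have "hom_assoc_algebra scale \<alpha> \<mu>" ..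
    moreover have "map_\<alpha> (coprod r s) (coprod r s a) = \<alpha>_map (coprod r s) (coprod r s a)" for a
      by (rule coassociative_coprod[OF assms])
        (use that in \<open>simp_all add: \<alpha>_map_coprod_prod map_\<alpha>_coprod_prod\<close>)
    \<comment> \<open>The compatibility conditions are instances of \<open>coprod_mult_map\<close>:
      \<open>p\<close>, \<open>q\<close>, \<open>u\<close> all equal to \<open>r\<close>, or all to
      \<open>s\<close>, for the coderivations, and \<open>p = r\<close>, \<open>q = s\<close> with
      \<open>u = r\<close> or \<open>u = s\<close> for \<triangle>'.\<close>
    ultimately show ?thesis
      unfolding covariant_hom_bialgebra_def
      using comm_map_coprod coprod_mult_map assms by auto
  qed
  then show ?thesis
    unfolding quasitriangular_def hom_Yang_Baxter_pair_iff[OF assms] by blast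
qed

subsection \<open>Pairing with functionals\<close>

text \<open>Applying a third functional to the vector left after contracting two factors yields an
  arbitrary product of three functionals, and these separate tensors.\<close>

lemma tensor3_eqI_first:
  assumes "t \<in> tensor3_space UNIV scale" "u \<in> tensor3_space UNIV scale"
    and eq: "\<And>\<phi> \<psi>. \<phi> \<in> dual scale \<Longrightarrow> \<psi> \<in> dual scale \<Longrightarrow>
      sw3 t (\<lambda>x y z. (\<phi> y * \<psi> z) *s x) = sw3 u (\<lambda>x y z. (\<phi> y * \<psi> z) *s x)"
  shows "t = u"
proof (rule tensor3_eqI[OF vector_space_axioms assms(1,2)])
  fix f g h assume f: "f \<in> dual scale" and gh: "g \<in> dual scale" "h \<in> dual scale"
  have "f (sw3 v (\<lambda>x y z. (g y * h z) *s x)) = sw3 v (\<lambda>x y z. f x * g y * h z)" for v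
    using f by (subst sweedler3_hom[where f = f])
      (simp_all add: dual_def Vector_Spaces.linear_iff ac_simps)
  then show "sw3 t (\<lambda>x y z. f x * g y * h z) = sw3 u (\<lambda>x y z. f x * g y * h z)"
    using eq[OF gh] by metis
qed

lemma tensor3_eqI_last:
  assumes "t \<in> tensor3_space UNIV scale" "u \<in> tensor3_space UNIV scale"
    and eq: "\<And>\<phi> \<psi>. \<phi> \<in> dual scale \<Longrightarrow> \<psi> \<in> dual scale \<Longrightarrow>
      sw3 t (\<lambda>x y z. (\<phi> x * \<psi> y) *s z) = sw3 u (\<lambda>x y z. (\<phi> x * \<psi> y) *s z)"
  shows "t = u"
proof (rule tensor3_eqI[OF vector_space_axioms assms(1,2)])
  fix f g h assume fg: "f \<in> dual scale" "g \<in> dual scale" and h: "h \<in> dual scale"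
  have "h (sw3 v (\<lambda>x y z. (f x * g y) *s z)) = sw3 v (\<lambda>x y z. f x * g y * h z)" for v
    using h by (subst sweedler3_hom[where f = h])
      (simp_all add: dual_def Vector_Spaces.linear_iff)
  then show "sw3 t (\<lambda>x y z. f x * g y * h z) = sw3 u (\<lambda>x y z. f x * g y * h z)"
    using eq[OF fg] by metis
qed

lemma dual_eval_trilinear:
  assumes "\<phi> \<in> dual scale" "\<psi> \<in> dual scale"
  shows "trilinear_on UNIV scale scale (\<lambda>x y z. (\<phi> y * \<psi> z) *s x)"
    and "trilinear_on UNIV scale scale (\<lambda>x y z. (\<phi> x * \<psi> y) *s z)"
  using assms
  by (auto intro!: trilinear_onI
      simp: dual_def Vector_Spaces.linear_iff algebra_simps)

section \<open>Equivalence of (ii) and (iii)\<close>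

lemma opp_mult_map_dual_tensor_map:
  "opp_mult_map (dual_tensor_map f g t) = dual_sw2 t (\<lambda>\<phi> \<psi>. g \<psi> \<cdot> f \<phi>)"
proof -
  have opp: "bilinear_on UNIV scale scale (\<lambda>a b. b \<cdot> a)"
    by (rule bilinear_onI) (simp_all add: linear_simps)
  show ?thesis
    unfolding opp_mult_map_def dual_tensor_map_def
    by (simp add: sw2_sw2[OF vector_space_axioms opp] tensor_mem
        sweedler2_elementary[OF vector_space_axioms opp])
qed

text \<open>Brings the sum over \<open>t\<close> to the outside, so that both sides of the first
  identity in (iii) are sums over \<open>t\<close> and can be compared by
  \<open>sweedler2_eq_iff\<close>.\<close>

lemma rho2_transpose:
  "rho2 p (transpose D t) = dual_sw2 t (\<lambda>\<phi> \<psi>. sw2 p (\<lambda>a b. sw2 (D b) (\<lambda>x y. \<phi> x * \<psi> y) *s \<alpha> a))"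
  unfolding rho2_def transpose_def pairing2_def
  by (subst sweedler2_swap[of _ _ t])
    (rule arg_cong[where f = "sw2 p"], intro ext sweedler2_hom[where f = "\<lambda>c. c *s _"],
      rule scale_left_distrib)

lemma lambda2_transpose:
  "lambda2 p (transpose D t) = dual_sw2 t (\<lambda>\<phi> \<psi>. sw2 p (\<lambda>a b. sw2 (D a) (\<lambda>x y. \<phi> x * \<psi> y) *s \<alpha> b))"
  unfolding lambda2_def transpose_def pairing2_def
  by (subst sweedler2_swap[of _ _ t])
    (rule arg_cong[where f = "sw2 p"], intro ext sweedler2_hom[where f = "\<lambda>c. c *s _"],
      rule scale_left_distrib)

lemma bilinear_on_dualI:
  assumes "\<And>x x' y. B (x + x') y = B x y + B x' y" "\<And>x y y'. B x (y + y') = B x y + B x y'"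
    and "\<And>c x y. B (fscale c x) y = c *s B x y" "\<And>c x y. B x (fscale c y) = c *s B x y"
  shows "bilinear_on (dual scale) fscale scale B"
  using assms by (simp add: bilinear_on_def linear_on_def)

lemma rho1_linear: "rho1 p (\<phi> + \<psi>) = rho1 p \<phi> + rho1 p \<psi>" "rho1 p (fscale c \<phi>) = c *s rho1 p \<phi>"
  and lambda1_linear: "lambda1 p (\<phi> + \<psi>) = lambda1 p \<phi> + lambda1 p \<psi>"
    "lambda1 p (fscale c \<phi>) = c *s lambda1 p \<phi>"
  by (simp_all add: rho1_def lambda1_def linear_simps fscale_def flip: scale_scale)

lemma sw2_product_scale:
  "sw2 u (\<lambda>x y. fscale c \<phi> x * \<psi> y) = c * sw2 u (\<lambda>x y. \<phi> x * \<psi> y)"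
  "sw2 u (\<lambda>x y. \<phi> x * fscale c \<psi> y) = c * sw2 u (\<lambda>x y. \<phi> x * \<psi> y)"
  unfolding sweedler2_scale[OF vector_space_mult, symmetric]
  by (simp_all add: fscale_def ac_simps)

lemma \<alpha>_map_mem: "\<alpha>_map D t \<in> tensor3_space UNIV scale"
  and map_\<alpha>_mem: "map_\<alpha> D t \<in> tensor3_space UNIV scale"
  unfolding \<alpha>_map_def map_\<alpha>_def by (intro sweedler2_mem3 tensor'_mem)+

text \<open>Both sides are contracted with \<phi> in the middle and \<psi> in the last factor. In
  \<open>prod_13_12 p p\<close> the middle factor belongs to the copy of \<open>p\<close> standing
  on the right of the product, so the contraction is
  \<open>rho1 p \<psi> \<cdot> rho1 p \<phi>\<close>. This reversal is why the opposite
  multiplication appears.\<close>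

lemma rho_iff:
  "(\<forall>t\<in>tensor2_space (dual scale) fscale.
      opp_mult_map (dual_tensor_map (rho1 p) (rho1 p) t) = rho2 p (transpose D t))
    \<longleftrightarrow> \<alpha>_map D p = prod_13_12 p p"
proof -
  let ?E = "\<lambda>\<phi> \<psi> v. sw3 v (\<lambda>x y z. (\<phi> y * \<psi> z) *s x)"
  have lhs: "rho1 p \<psi> \<cdot> rho1 p \<phi> = ?E \<phi> \<psi> (prod_13_12 p p)"
    if "\<phi> \<in> dual scale" "\<psi> \<in> dual scale" for \<phi> \<psi>
    unfolding sw3_prod[OF vector_space_axioms dual_eval_trilinear(1)[OF that]] rho1_def
    by (subst sweedler2_hom[where f = "\<lambda>v. v \<cdot> _"], simp add: linear_simps,
        subst sweedler2_hom[where f = "\<lambda>v. _ \<cdot> v"], simp add: linear_simps)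
      (simp add: linear_simps mult.commute)
  have rhs: "sw2 p (\<lambda>a b. sw2 (D b) (\<lambda>x y. \<phi> x * \<psi> y) *s \<alpha> a) = ?E \<phi> \<psi> (\<alpha>_map D p)"
    if "\<phi> \<in> dual scale" "\<psi> \<in> dual scale" for \<phi> \<psi>
  proof -
    note tri = dual_eval_trilinear(1)[OF that]
    show ?thesis
      unfolding \<alpha>_map_def
      by (subst sweedler2_hom[where f = "\<lambda>c. c *s _"], simp add: linear_simps)
        (simp add: sw3_sw2[OF vector_space_axioms tri] sweedler2_mem3 tensor'_mem
          sweedler3_elementary[OF vector_space_axioms tri])
  qed
  have "bilinear_on (dual scale) fscale scale (\<lambda>\<phi> \<psi>. rho1 p \<psi> \<cdot> rho1 p \<phi>)"
    by (rule bilinear_on_dualI) (simp_all add: linear_simps rho1_linear)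
  moreover have "bilinear_on (dual scale) fscale scale
      (\<lambda>\<phi> \<psi>. sw2 p (\<lambda>a b. sw2 (D b) (\<lambda>x y. \<phi> x * \<psi> y) *s \<alpha> a))"
    by (rule bilinear_on_dualI) (simp_all add: linear_simps distrib_left distrib_right sw2_product_scale
        flip: scale_scale)
  ultimately show ?thesis
    unfolding opp_mult_map_dual_tensor_map rho2_transpose
    using sweedler2_eq_iff[OF vector_space_fscale subspace_dual[OF vector_space_axioms]
        vector_space_axioms] tensor3_eqI_first[OF \<alpha>_map_mem prod_mem(1), of D p p p]
    by (simp add: lhs rhs) metis
qed

text \<open>The mirror image of \<open>rho_iff\<close>, contracting the first two factors. In
  \<open>prod_23_13 p p\<close> the first factor comes from the copy on the right of the product,
  which again reverses the order.\<close>

lemma lambda_iff: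
  "(\<forall>t\<in>tensor2_space (dual scale) fscale.
      - opp_mult_map (dual_tensor_map (lambda1 p) (lambda1 p) t) = lambda2 p (transpose D t))
    \<longleftrightarrow> map_\<alpha> D p = - prod_23_13 p p"
proof -
  let ?E = "\<lambda>\<phi> \<psi> v. sw3 v (\<lambda>x y z. (\<phi> x * \<psi> y) *s z)"
  interpret F: vector_space fscale by (rule vector_space_fscale)
  have minus_mem: "- prod_23_13 p p \<in> tensor3_space UNIV scale"
    using subspace_tensor3_space prod_mem(3) by (rule F.subspace_neg)
  have lhs: "- (lambda1 p \<psi> \<cdot> lambda1 p \<phi>) = ?E \<phi> \<psi> (- prod_23_13 p p)"
    if "\<phi> \<in> dual scale" "\<psi> \<in> dual scale" for \<phi> \<psi>
  proof -
    note tri = dual_eval_trilinear(2)[OF that]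
    have "lambda1 p \<psi> \<cdot> lambda1 p \<phi> = ?E \<phi> \<psi> (prod_23_13 p p)"
      unfolding sw3_prod[OF vector_space_axioms tri] lambda1_def
      by (subst sweedler2_hom[where f = "\<lambda>v. v \<cdot> _"], simp add: linear_simps,
          subst sweedler2_hom[where f = "\<lambda>v. _ \<cdot> v"], simp add: linear_simps)
        (simp add: linear_simps mult.commute)
    \<comment> \<open>Compatibility of \<open>?E\<close> with negation is obtained from
      \<open>sw3_diff\<close> by writing \<open>- t\<close> as \<open>0 - t\<close>.\<close>
    moreover have "?E \<phi> \<psi> 0 = 0"
      using sw3_diff[OF vector_space_axioms tri prod_mem(3) prod_mem(3), of p p p p] by simp
    ultimately show ?thesis
      using sw3_diff[OF vector_space_axioms tri F.subspace_0[OF subspace_tensor3_space] prod_mem(3),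
          of p p]
      by simp
  qed
  have rhs: "sw2 p (\<lambda>a b. sw2 (D a) (\<lambda>x y. \<phi> x * \<psi> y) *s \<alpha> b) = ?E \<phi> \<psi> (map_\<alpha> D p)"
    if "\<phi> \<in> dual scale" "\<psi> \<in> dual scale" for \<phi> \<psi>
  proof -
    note tri = dual_eval_trilinear(2)[OF that]
    show ?thesis
      unfolding map_\<alpha>_def
      by (subst sweedler2_hom[where f = "\<lambda>c. c *s _"], simp add: linear_simps)
        (simp add: sw3_sw2[OF vector_space_axioms tri] sweedler2_mem3 tensor'_mem
          sweedler3_elementary[OF vector_space_axioms tri])
  qed
  have "bilinear_on (dual scale) fscale scale (\<lambda>\<phi> \<psi>. - (lambda1 p \<psi> \<cdot> lambda1 p \<phi>))"
    by (rule bilinear_on_dualI) (simp_all add: linear_simps lambda1_linear)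
  moreover have "bilinear_on (dual scale) fscale scale
      (\<lambda>\<phi> \<psi>. sw2 p (\<lambda>a b. sw2 (D a) (\<lambda>x y. \<phi> x * \<psi> y) *s \<alpha> b))"
    by (rule bilinear_on_dualI)
      (simp_all add: linear_simps distrib_left distrib_right sw2_product_scale
        flip: scale_scale)
  ultimately show ?thesis
    unfolding opp_mult_map_dual_tensor_map lambda2_transpose sweedler2_uminus[symmetric]
    using sweedler2_eq_iff[OF vector_space_fscale subspace_dual[OF vector_space_axioms]
        vector_space_axioms] tensor3_eqI_last[OF map_\<alpha>_mem minus_mem, of D p]
    by (simp add: lhs rhs) metis
qed

end

theorem theorem5p8:
  fixes scale :: "'k::field \<Rightarrow> 'a::ab_group_add \<Rightarrow> 'a"
    and \<alpha> :: "'a \<Rightarrow> 'a" and \<mu> :: "'a \<Rightarrow> 'a \<Rightarrow> 'a"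
    and r s :: "('k, 'a) tensor2"
  assumes "hom_assoc_algebra scale \<alpha> \<mu>"
    and "r \<in> tensor2_space UNIV scale" and "hom_assoc_algebra.invariant scale \<alpha> r"
    and "s \<in> tensor2_space UNIV scale" and "hom_assoc_algebra.invariant scale \<alpha> s"
  shows
    "(hom_assoc_algebra.quasitriangular scale \<alpha> \<mu> r s
      \<longleftrightarrow>
      hom_assoc_algebra.\<alpha>_map scale \<alpha> (hom_assoc_algebra.coprod scale \<alpha> \<mu> r s) r
        = hom_assoc_algebra.prod_13_12 scale \<alpha> \<mu> r r \<and>
      hom_assoc_algebra.map_\<alpha> scale \<alpha> (hom_assoc_algebra.coprod scale \<alpha> \<mu> r s) s
        = - hom_assoc_algebra.prod_23_13 scale \<alpha> \<mu> s s)
     \<and>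
     (hom_assoc_algebra.quasitriangular scale \<alpha> \<mu> r s
      \<longleftrightarrow>
      (\<forall>t \<in> tensor2_space (dual scale) fscale.
        hom_assoc_algebra.opp_mult_map scale \<mu>
            (hom_assoc_algebra.dual_tensor_map scale
              (hom_assoc_algebra.rho1 scale \<alpha> r) (hom_assoc_algebra.rho1 scale \<alpha> r) t)
          = hom_assoc_algebra.rho2 scale \<alpha> r
              (hom_assoc_algebra.transpose scale (hom_assoc_algebra.coprod scale \<alpha> \<mu> r s) t)) \<and>
      (\<forall>t \<in> tensor2_space (dual scale) fscale.
        - hom_assoc_algebra.opp_mult_map scale \<mu>
            (hom_assoc_algebra.dual_tensor_map scale
              (hom_assoc_algebra.lambda1 scale \<alpha> s) (hom_assoc_algebra.lambda1 scale \<alpha> s) t)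
          = hom_assoc_algebra.lambda2 scale \<alpha> s
              (hom_assoc_algebra.transpose scale (hom_assoc_algebra.coprod scale \<alpha> \<mu> r s) t)))"
proof -
  interpret hom_assoc_algebra scale \<alpha> \<mu> by fact
  \<comment> \<open>With \<open>coprod r s\<close> for \<open>D\<close>, the two rewrites turn (iii)
    into (ii), so both equivalences become \<open>quasitriangular_iff\<close>.\<close>
  show ?thesis
    unfolding rho_iff lambda_iff using quasitriangular_iff[OF assms(2-5)] by blast
qed

end
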